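(* Let $p\ge1$ be an integer. There is a constant $C>0$ depending only on $p$ such that the following holds. Let $L,\mu>0$, let $\mathcal X\subseteq\mathbb R^d$ ($d\ge1$) be closed, convex and bounded with diameter $D>0$, let $F:\mathbb R^d\to\mathbb R^d$ be $(p-1)^{\text{th}}$-order $L$-smooth and $p^{\text{th}}$-order $\mu$-uniformly monotone, let $\kappa=L/\mu$, let $x^\star\in\mathcal X$ be a weak solution, i.e. $\langle F(x),x-x^\star\rangle\ge0$ for all $x\in\mathcal X$, and let $x_0\in\mathcal X$, $\epsilon\in(0,1)$. Then there is an integer $T\ge0$, depending only on $p,D,\epsilon$, with $$T\le C\max\{1,\log_2(D/\epsilon)\},$$ such that every output $\hat x$ of $\mathsf{Perseus\text{-}restart}(p,x_0,L,\mu,D,T,0)$ satisfies $\|\hat x-x^\star\|\le\epsilon$, and the total number of calls of the subproblem solver is at most $$C\,\kappa^{\frac{2}{p+1}}\max\{1,\log_2(D/\epsilon)\}.$$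
   Context: Norms are Euclidean. The diameter is $D=\max_{x,x'\in\mathcal X}\|x-x'\|$. $F$ is $(p-1)^{\text{th}}$-order $L$-smooth if it is $(p-1)$ times continuously differentiable and $\|\nabla^{(p-1)}F(x)-\nabla^{(p-1)}F(x')\|_{\mathrm{op}}\le L\|x-x'\|$ for all $x,x'\in\mathbb R^d$ (operator norm of multilinear maps; $\nabla^{(0)}F=F$). $F$ is $p^{\text{th}}$-order $\mu$-uniformly monotone if $\langle F(x)-F(x'),x-x'\rangle\ge\mu\|x-x'\|^{p+1}$ for all $x,x'\in\mathbb R^d$. For $v\in\mathcal X$ define $$F_v(x)=\sum_{j=0}^{p-1}\tfrac1{j!}\nabla^{(j)}F(v)[x-v]^j+\tfrac{5L}{(p-1)!}\|x-v\|^{p-1}(x-v)$$ (for $p=1$: $F_v(x)=F(v)+5L(x-v)$). Method $\mathsf{Perseus}(p,x_0,L,T,\mathsf{opt})$ with $\mathsf{opt}=0$. Set $s_0=0$. For $k=0,1,\dots,T-1$: (1) if $x_k$ is a solution of the VI, i.e. $\langle F(x_k),x-x_k\rangle\ge0$ for all $x\in\mathcal X$, stop and return $x_k$; (2) $v_{k+1}=\operatorname{argmax}_{v\in\mathcal X}\{\langle s_k,v-x_0\rangle-\frac12\|v-x_0\|^2\}$; (3) (one call of the subproblem solver) take any $x_{k+1}\in\mathcal X$ with $\sup_{x\in\mathcal X}\langle F_{v_{k+1}}(x_{k+1}),x_{k+1}-x\rangle\le\frac{L}{p!}\|x_{k+1}-v_{k+1}\|^{p+1}$; (4) take any $\lambda_{k+1}>0$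 with $\frac1{20p-8}\le\frac{\lambda_{k+1}L\|x_{k+1}-v_{k+1}\|^{p-1}}{p!}\le\frac1{10p+2}$ (with the convention $t^0=1$; if $p\ge2$ and $x_{k+1}=v_{k+1}$, then $x_{k+1}$ is a solution of the VI and the method stops and returns it); (5) $s_{k+1}=s_k-\lambda_{k+1}F(x_{k+1})$. If it did not stop early, the output is $\frac{1}{\sum_{k=1}^T\lambda_k}\sum_{k=1}^T\lambda_kx_k$. Method $\mathsf{Perseus\text{-}restart}(p,x_0,L,\mu,D,T,0)$. Set $T_{\mathrm{inner}}=\Big\lceil\big(\tfrac{2^{p+1}(5p-2)}{p!}\tfrac{L}{\mu}\big)^{\frac2{p+1}}\Big\rceil$. For $k=0,1,\dots,T$: if $x_k$ is a solution of the VI, stop and return $x_k$; otherwise let $x_{k+1}$ be an output of $\mathsf{Perseus}(p,x_k,L,T_{\mathrm{inner}},0)$ (started afresh at $x_k$). The output is $x_{T+1}$ (if not stopped early). *)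

theory Defs
  imports "HOL-Analysis.Analysis" "HOL-Library.Poly_Mapping"
begin

section \<open>Euclidean spaces of variable dimension\<close>

text \<open>
  The constant in the theorem must not depend on the dimension \<open>d\<close>, so \<open>d\<close> has to be
  quantified inside the formula and cannot be carried by a type. All spaces \<open>R^d\<close> therefore
  live in one type: the finitely supported sequences \<open>nat \<Rightarrow>\<^sub>0 real\<close> with the inner product
  \<open>\<Sum>i. x i * y i\<close>, where \<open>R^d\<close> is the subspace of sequences supported in \<open>{..<d}\<close>.
\<close>

instantiation poly_mapping :: (type, real_vector) real_vector
begin

lift_definition scaleR_poly_mapping :: "real \<Rightarrow> ('a \<Rightarrow>\<^sub>0 'b) \<Rightarrow> ('a \<Rightarrow>\<^sub>0 'b)"
  is "\<lambda>r f k. r *\<^sub>R f k"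
  by (erule finite_subset[rotated]) auto

instance
  by standard (transfer, simp add: fun_eq_iff scaleR_add_right scaleR_add_left)+

end

instantiation poly_mapping :: (type, real_inner) real_inner
begin

definition inner_poly_mapping :: "('a \<Rightarrow>\<^sub>0 'b) \<Rightarrow> ('a \<Rightarrow>\<^sub>0 'b) \<Rightarrow> real"
  where "inner_poly_mapping x y = (\<Sum>k\<in>Poly_Mapping.keys x. Poly_Mapping.lookup x k \<bullet> Poly_Mapping.lookup y k)"

definition norm_poly_mapping :: "('a \<Rightarrow>\<^sub>0 'b) \<Rightarrow> real"
  where "norm_poly_mapping x = sqrt (inner x x)"

definition dist_poly_mapping :: "('a \<Rightarrow>\<^sub>0 'b) \<Rightarrow> ('a \<Rightarrow>\<^sub>0 'b) \<Rightarrow> real"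
  where "dist_poly_mapping x y = norm (x - y)"

definition sgn_poly_mapping :: "('a \<Rightarrow>\<^sub>0 'b) \<Rightarrow> ('a \<Rightarrow>\<^sub>0 'b)"
  where "sgn_poly_mapping x = x /\<^sub>R norm x"

definition uniformity_poly_mapping :: "(('a \<Rightarrow>\<^sub>0 'b) \<times> ('a \<Rightarrow>\<^sub>0 'b)) filter"
  where "uniformity_poly_mapping = (INF e\<in>{0<..}. principal {(x, y). dist x y < e})"

definition open_poly_mapping :: "('a \<Rightarrow>\<^sub>0 'b) set \<Rightarrow> bool"
  where "open_poly_mapping U \<longleftrightarrow> (\<forall>x\<in>U. eventually (\<lambda>(x', y). x' = x \<longrightarrow> y \<in> U) uniformity)"

instance
proof
  fix x y z :: "'a \<Rightarrow>\<^sub>0 'b" and r :: real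
  have sum_eq: "inner u w = (\<Sum>k\<in>A. Poly_Mapping.lookup u k \<bullet> Poly_Mapping.lookup w k)"
    if "finite A" "Poly_Mapping.keys u \<subseteq> A" for u w :: "'a \<Rightarrow>\<^sub>0 'b" and A
    unfolding inner_poly_mapping_def using that
    by (intro sum.mono_neutral_left) (auto simp: in_keys_iff)
  show "sgn x = x /\<^sub>R norm x"
    by (rule sgn_poly_mapping_def)
  show "dist x y = norm (x - y)"
    by (rule dist_poly_mapping_def)
  show "uniformity = (INF e\<in>{0<..}. principal {(x, y :: 'a \<Rightarrow>\<^sub>0 'b). dist x y < e})"
    by (rule uniformity_poly_mapping_def)
  show "open U \<longleftrightarrow> (\<forall>x\<in>U. eventually (\<lambda>(x', y). x' = x \<longrightarrow> y \<in> U) uniformity)"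
    for U :: "('a \<Rightarrow>\<^sub>0 'b) set"
    by (rule open_poly_mapping_def)
  define A where "A = Poly_Mapping.keys x \<union> Poly_Mapping.keys y"
  have A: "finite A" "Poly_Mapping.keys x \<subseteq> A" "Poly_Mapping.keys y \<subseteq> A"
    "Poly_Mapping.keys (x + y) \<subseteq> A" "Poly_Mapping.keys (r *\<^sub>R x) \<subseteq> A"
    using Poly_Mapping.keys_add[of x y]
    by (auto simp: A_def in_keys_iff scaleR_poly_mapping.rep_eq)
  show "inner x y = inner y x"
    using A by (simp add: sum_eq[of A] inner_commute)
  show "inner (x + y) z = inner x z + inner y z"
    using A by (simp add: sum_eq[of A] lookup_add inner_add_left sum.distrib)
  show "inner (r *\<^sub>R x) y = r * inner x y"
    using A by (simp add: sum_eq[of A] scaleR_poly_mapping.rep_eq sum_distrib_left)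
  show "0 \<le> inner x x"
    by (simp add: inner_poly_mapping_def sum_nonneg)
  show "inner x x = 0 \<longleftrightarrow> x = 0"
    by (simp add: inner_poly_mapping_def sum_nonneg_eq_0_iff)
       (metis in_keys_iff keys_eq_empty ex_in_conv empty_iff)
  show "norm x = sqrt (inner x x)"
    by (rule norm_poly_mapping_def)
qed

end

definition Rn :: "nat \<Rightarrow> (nat \<Rightarrow>\<^sub>0 real) set"
  where "Rn d = {x. Poly_Mapping.keys x \<subseteq> {..<d}}"

lemma inner_Rn:
  assumes "x \<in> Rn d"
  shows "x \<bullet> y = (\<Sum>i<d. Poly_Mapping.lookup x i * Poly_Mapping.lookup y i)"
  unfolding inner_poly_mapping_def inner_real_def using assms
  by (intro sum.mono_neutral_left) (auto simp: Rn_def in_keys_iff)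

lemma norm_Rn:
  assumes "x \<in> Rn d"
  shows "norm x = L2_set (Poly_Mapping.lookup x) {..<d}"
  using inner_Rn[OF assms, of x] by (simp add: norm_eq_sqrt_inner L2_set_def power2_eq_square)

lemma subspace_Rn: "subspace (Rn d)"
  by (auto simp: subspace_def Rn_def in_keys_iff lookup_add scaleR_poly_mapping.rep_eq subset_iff)
     (metis add_0)


section \<open>Derivatives of higher order\<close>

text \<open>
  In this section and the following ones, \<open>V\<close> is a finite-dimensional subspace (in the theorem,
  \<open>V = R^d\<close>) and \<open>F\<close> is a map on \<open>V\<close>; its values outside \<open>V\<close> are irrelevant. Derivatives are
  taken within \<open>V\<close> and applied to directions in \<open>V\<close> only, where they are unique.

  \<open>higher_deriv V F [h\<^sub>1, \<dots>, h\<^sub>j] x\<close> is the value at \<open>(h\<^sub>1, \<dots>, h\<^sub>j)\<close> of the multilinear map that is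
  the \<open>j\<close>-th Frechet derivative of \<open>F\<close> at \<open>x\<close>.
\<close>

primrec higher_deriv ::
    "'a::real_normed_vector set \<Rightarrow> ('a \<Rightarrow> 'b::real_normed_vector) \<Rightarrow> 'a list \<Rightarrow> 'a \<Rightarrow> 'b" where
  "higher_deriv V F [] = F"
| "higher_deriv V F (h # hs) = (\<lambda>x. frechet_derivative (higher_deriv V F hs) (at x within V) h)"

text \<open>
  As \<open>V\<close> is finite-dimensional, a map into the \<open>j\<close>-linear maps on \<open>V\<close> is differentiable
  (continuous) iff its evaluation at every \<open>j\<close>-tuple of vectors in \<open>V\<close> is.
\<close>

definition times_cont_diff_on ::
    "nat \<Rightarrow> 'a::real_normed_vector set \<Rightarrow> ('a \<Rightarrow> 'b::real_normed_vector) \<Rightarrow> bool" where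
  "times_cont_diff_on k V F \<longleftrightarrow>
     (\<forall>hs. set hs \<subseteq> V \<and> length hs < k \<longrightarrow> higher_deriv V F hs differentiable_on V) \<and>
     (\<forall>hs. set hs \<subseteq> V \<and> length hs = k \<longrightarrow> continuous_on V (higher_deriv V F hs))"

text \<open>The operator norm of a \<open>k\<close>-linear map on \<open>V\<close>; for \<open>k = 0\<close> it is the norm of the value.\<close>

definition multi_onorm ::
    "nat \<Rightarrow> 'a::real_normed_vector set \<Rightarrow> ('a list \<Rightarrow> 'b::real_normed_vector) \<Rightarrow> real" where
  "multi_onorm k V M = Sup {norm (M hs) | hs. length hs = k \<and> (\<forall>h\<in>set hs. h \<in> V \<and> norm h \<le> 1)}"

definition order_smooth ::
    "nat \<Rightarrow> real \<Rightarrow> 'a::real_normed_vector set \<Rightarrow> ('a \<Rightarrow> 'b::real_normed_vector) \<Rightarrow> bool" where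
  "order_smooth k L V F \<longleftrightarrow>
     times_cont_diff_on k V F \<and>
     (\<forall>x\<in>V. \<forall>x'\<in>V.
        multi_onorm k V (\<lambda>hs. higher_deriv V F hs x - higher_deriv V F hs x') \<le> L * norm (x - x'))"

definition order_uniformly_monotone ::
    "nat \<Rightarrow> real \<Rightarrow> 'a::real_inner set \<Rightarrow> ('a \<Rightarrow> 'a) \<Rightarrow> bool" where
  "order_uniformly_monotone p \<mu> V F \<longleftrightarrow>
     (\<forall>x\<in>V. \<forall>x'\<in>V. (F x - F x') \<bullet> (x - x') \<ge> \<mu> * norm (x - x') ^ (p + 1))"


section \<open>Variational inequalities and the methods\<close>

definition vi_solution :: "'a::real_inner set \<Rightarrow> ('a \<Rightarrow> 'a) \<Rightarrow> 'a \<Rightarrow> bool" where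
  "vi_solution X F z \<longleftrightarrow> z \<in> X \<and> (\<forall>x\<in>X. F z \<bullet> (x - z) \<ge> 0)"

definition weak_vi_solution :: "'a::real_inner set \<Rightarrow> ('a \<Rightarrow> 'a) \<Rightarrow> 'a \<Rightarrow> bool" where
  "weak_vi_solution X F z \<longleftrightarrow> z \<in> X \<and> (\<forall>x\<in>X. F x \<bullet> (x - z) \<ge> 0)"

definition reg_taylor ::
    "'a::real_inner set \<Rightarrow> ('a \<Rightarrow> 'a) \<Rightarrow> nat \<Rightarrow> real \<Rightarrow> 'a \<Rightarrow> 'a \<Rightarrow> 'a" where
  "reg_taylor V F p L v x =
     (\<Sum>j<p. (1 / fact j) *\<^sub>R higher_deriv V F (replicate j (x - v)) v) +
     (5 * L / fact (p - 1) * norm (x - v) ^ (p - 1)) *\<^sub>R (x - v)"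

definition dual_step :: "'a::real_inner set \<Rightarrow> 'a \<Rightarrow> 'a \<Rightarrow> 'a \<Rightarrow> bool" where
  "dual_step X x0 s v \<longleftrightarrow>
     is_arg_max (\<lambda>v. s \<bullet> (v - x0) - 1 / 2 * (norm (v - x0))\<^sup>2) (\<lambda>v. v \<in> X) v"

definition subproblem_answer ::
    "'a::real_inner set \<Rightarrow> 'a set \<Rightarrow> ('a \<Rightarrow> 'a) \<Rightarrow> nat \<Rightarrow> real \<Rightarrow> 'a \<Rightarrow> 'a \<Rightarrow> bool" where
  "subproblem_answer V X F p L v y \<longleftrightarrow>
     y \<in> X \<and>
     (SUP x\<in>X. reg_taylor V F p L v y \<bullet> (y - x)) \<le> L / fact p * norm (y - v) ^ (p + 1)"

definition step_size :: "nat \<Rightarrow> real \<Rightarrow> 'a::real_inner \<Rightarrow> 'a \<Rightarrow> real \<Rightarrow> bool" where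
  "step_size p L v y l \<longleftrightarrow>
     l > 0 \<and>
     1 / (20 * real p - 8) \<le> l * L * norm (y - v) ^ (p - 1) / fact p \<and>
     l * L * norm (y - v) ^ (p - 1) / fact p \<le> 1 / (10 * real p + 2)"

text \<open>
  The methods are nondeterministic, so their runs are described by relations.
  \<open>perseus_state V X F p x0 L T k x s \<Lambda> w\<close>: some run has completed \<open>k \<le> T\<close> iterations without
  stopping, with current \<open>x\<^sub>k = x\<close>, \<open>s\<^sub>k = s\<close>, \<open>\<Lambda> = \<lambda>\<^sub>1 + \<dots> + \<lambda>\<^sub>k\<close> and \<open>w = \<lambda>\<^sub>1 x\<^sub>1 + \<dots> + \<lambda>\<^sub>k x\<^sub>k\<close>.
\<close>

inductive perseus_state ::
    "'a::real_inner set \<Rightarrow> 'a set \<Rightarrow> ('a \<Rightarrow> 'a) \<Rightarrow> nat \<Rightarrow> 'a \<Rightarrow> real \<Rightarrow> nat \<Rightarrow>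
     nat \<Rightarrow> 'a \<Rightarrow> 'a \<Rightarrow> real \<Rightarrow> 'a \<Rightarrow> bool"
  for V X F p x0 L T where
  init: "perseus_state V X F p x0 L T 0 x0 0 0 0"
| step: "perseus_state V X F p x0 L T (Suc k) y (s - l *\<^sub>R F y) (\<Lambda> + l) (w + l *\<^sub>R y)"
  if "perseus_state V X F p x0 L T k x s \<Lambda> w" "k < T" "\<not> vi_solution X F x"
     "dual_step X x0 s v" "subproblem_answer V X F p L v y" "\<not> (p \<ge> 2 \<and> y = v)"
     "step_size p L v y l"

text \<open>\<open>perseus_output V X F p x0 L T z n\<close>: some run returns \<open>z\<close> after \<open>n\<close> subproblem solver calls.\<close>

inductive perseus_output ::
    "'a::real_inner set \<Rightarrow> 'a set \<Rightarrow> ('a \<Rightarrow> 'a) \<Rightarrow> nat \<Rightarrow> 'a \<Rightarrow> real \<Rightarrow> nat \<Rightarrow> 'a \<Rightarrow> nat \<Rightarrow> bool"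
  for V X F p x0 L T where
  stop_at_solution: "perseus_output V X F p x0 L T x k"
  if "perseus_state V X F p x0 L T k x s \<Lambda> w" "k < T" "vi_solution X F x"
| stop_at_fixpoint: "perseus_output V X F p x0 L T y (Suc k)"
  if "perseus_state V X F p x0 L T k x s \<Lambda> w" "k < T" "\<not> vi_solution X F x"
     "dual_step X x0 s v" "subproblem_answer V X F p L v y" "p \<ge> 2" "y = v"
| finish: "perseus_output V X F p x0 L T ((1 / \<Lambda>) *\<^sub>R w) T"
  if "perseus_state V X F p x0 L T T x s \<Lambda> w"

definition T_inner :: "nat \<Rightarrow> real \<Rightarrow> real \<Rightarrow> nat" where
  "T_inner p L \<mu> =
     nat \<lceil>(2 ^ (p + 1) * (5 * real p - 2) / fact p * (L / \<mu>)) powr (2 / (real p + 1))\<rceil>"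

text \<open>
  \<open>restart_state \<dots> k x n\<close>: some run has completed \<open>k \<le> T + 1\<close> rounds without stopping, with
  \<open>x\<^sub>k = x\<close> and \<open>n\<close> subproblem solver calls in total. The argument \<open>D\<close> of the method is not used
  by its steps and is omitted.
\<close>

inductive restart_state ::
    "'a::real_inner set \<Rightarrow> 'a set \<Rightarrow> ('a \<Rightarrow> 'a) \<Rightarrow> nat \<Rightarrow> 'a \<Rightarrow> real \<Rightarrow> real \<Rightarrow> nat \<Rightarrow>
     nat \<Rightarrow> 'a \<Rightarrow> nat \<Rightarrow> bool"
  for V X F p x0 L \<mu> T where
  init: "restart_state V X F p x0 L \<mu> T 0 x0 0"
| step: "restart_state V X F p x0 L \<mu> T (Suc k) y (n + m)"
  if "restart_state V X F p x0 L \<mu> T k x n" "k \<le> T" "\<not> vi_solution X F x"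
     "perseus_output V X F p x L (T_inner p L \<mu>) y m"

inductive restart_output ::
    "'a::real_inner set \<Rightarrow> 'a set \<Rightarrow> ('a \<Rightarrow> 'a) \<Rightarrow> nat \<Rightarrow> 'a \<Rightarrow> real \<Rightarrow> real \<Rightarrow> nat \<Rightarrow>
     'a \<Rightarrow> nat \<Rightarrow> bool"
  for V X F p x0 L \<mu> T where
  stop_at_solution: "restart_output V X F p x0 L \<mu> T x n"
  if "restart_state V X F p x0 L \<mu> T k x n" "k \<le> T" "vi_solution X F x"
| finish: "restart_output V X F p x0 L \<mu> T x n"
  if "restart_state V X F p x0 L \<mu> T (Suc T) x n"

end

theory Submission
  imports Defs
begin

text \<open>
  Let \<open>z\<close> be the weak solution. As \<open>F\<close> is continuous, \<open>z\<close> also solves the variational inequality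
  itself (\<open>weak_vi_solution_imp_vi_solution\<close>), and uniform monotonicity makes it the only solution.
  A run that stops early therefore returns \<open>z\<close>, and only runs that use up their rounds matter.

  \<^emph>\<open>One inner run.\<close> Write \<open>a\<^sub>i\<close> for the distance between the dual point \<open>v\<^sub>i\<close> and the answer \<open>y\<^sub>i\<close> of
  the subproblem solver. Taylor's formula bounds the error of the model \<open>F\<^sub>v\<close> by
  \<open>L a\<^sub>i\<^sup>p / p!\<close>, the regularisation in \<open>F\<^sub>v\<close> outweighs that error, and the maximiser
  \<open>v\<^sub>i\<close> of a strongly concave function moves by an amount that pays for the mismatch between
  consecutive dual points. With step sizes \<open>\<lambda>\<^sub>i\<close> of order \<open>p! / (L a\<^sub>i\<^sup>p\<^sup>-\<^sup>1)\<close> this yields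
  (\<open>perseus_run_regret\<close>)

    \<open>\<Sum>\<^sub>i \<lambda>\<^sub>i (F y\<^sub>i \<bullet> (y\<^sub>i - z)) + 1/8 \<Sum>\<^sub>i a\<^sub>i\<^sup>2 \<le> 1/2 R\<^sup>2\<close>,  where \<open>R\<close> is the distance from the start to \<open>z\<close>.

  Both terms on the left are useful. The second one says that the \<open>a\<^sub>i\<close> are small on average, so
  the step sizes are large: by convexity \<open>\<Lambda> = \<Sum>\<^sub>i \<lambda>\<^sub>i\<close> is at least of order
  \<open>T\<^bsup>(p+1)/2\<^esup> / (L R\<^bsup>p-1\<^esup>)\<close>. The first one dominates \<open>\<mu> \<Sum>\<^sub>i \<lambda>\<^sub>i |y\<^sub>i - z|\<^bsup>p+1\<^esup>\<close>, hence also
  \<open>\<mu> \<Lambda>\<close> times the \<open>(p+1)\<close>-st power of the distance from the averaged output to \<open>z\<close>. The length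
  \<open>T_inner\<close> is what turns these two facts into the statement that a run halves the \<open>(p+1)\<close>-st power
  of the distance to \<open>z\<close> (\<open>perseus_run_contraction\<close>).

  \<^emph>\<open>Restarting.\<close> After \<open>T + 1\<close> halvings the \<open>(p+1)\<close>-st power of the distance is at most
  \<open>D\<^bsup>p+1\<^esup> / 2\<^bsup>T+1\<^esup>\<close>, so \<open>T\<close> of order \<open>(p + 1) log\<^sub>2 (D/\<epsilon>)\<close> suffices. The number of solver calls is at
  most \<open>(T + 1) T_inner\<close>. In \<open>T_inner\<close> a real number of order \<open>(L/\<mu>)\<^bsup>2/(p+1)\<^esup>\<close> is rounded up,
  and the claimed bound would fail if \<open>L/\<mu>\<close> could be arbitrarily small. It cannot: on the whole space
  uniform monotonicity forces \<open>F\<close> to grow at least like \<open>\<mu> r\<^sup>p\<close>, while smoothness allows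
  at most \<open>L r\<^sup>p / p!\<close>, so that \<open>p! \<mu> \<le> L\<close> (\<open>smoothness_dominates_monotonicity\<close>).
\<close>

section \<open>Higher derivatives along a subspace\<close>

lemma has_vector_derivative_along_line:
  assumes V: "subspace V" "v \<in> V" "e \<in> V"
    and f: "(f has_derivative f') (at (v + t *\<^sub>R e) within V)"
  shows "((\<lambda>t. f (v + t *\<^sub>R e)) has_vector_derivative f' e) (at t)"
proof -
  have line: "((\<lambda>t. v + t *\<^sub>R e) has_derivative (\<lambda>s. s *\<^sub>R e)) (at t)"
    by (auto intro!: derivative_eq_intros)
  have "range (\<lambda>t. v + t *\<^sub>R e) \<subseteq> V"
    using V by (auto intro: subspace_add subspace_scale)
  then have "((\<lambda>t. f (v + t *\<^sub>R e)) has_derivative (\<lambda>s. f' (s *\<^sub>R e))) (at t)"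
    using has_derivative_in_compose[OF line has_derivative_subset[OF f]] by simp
  moreover have "f' (s *\<^sub>R e) = s *\<^sub>R f' e" for s
    using has_derivative_bounded_linear[OF f] by (simp add: linear_simps)
  ultimately show ?thesis
    by (simp add: has_vector_derivative_def)
qed

text \<open>
  On a proper subspace there are many derivatives within \<open>V\<close>, and \<open>frechet_derivative\<close> chooses one
  of them. They all agree in the directions of \<open>V\<close>, because there each is the ordinary derivative
  along a line. This is what makes \<open>higher_deriv\<close> computable.
\<close>

lemma frechet_derivative_on_subspace:
  assumes V: "subspace V" "x \<in> V" "h \<in> V" and f: "(f has_derivative f') (at x within V)"
  shows "frechet_derivative f (at x within V) h = f' h"
proof (rule vector_derivative_unique_at)
  have "(f has_derivative frechet_derivative f (at x within V)) (at x within V)"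
    using f frechet_derivative_works differentiable_def by blast
  from has_vector_derivative_along_line[OF V, of f _ 0, simplified, OF this]
  show "((\<lambda>t. f (x + t *\<^sub>R h)) has_vector_derivative frechet_derivative f (at x within V) h) (at 0)" .
  from has_vector_derivative_along_line[OF V, of f _ 0, simplified, OF f]
  show "((\<lambda>t. f (x + t *\<^sub>R h)) has_vector_derivative f' h) (at 0)" .
qed

text \<open>
  A higher derivative is linear in each of its arguments. In the outermost one this is linearity of
  a derivative; in any other one it is an identity between functions on \<open>V\<close> that may be
  differentiated in the remaining directions. Stated for linear combinations, it gives both the
  homogeneity that rescales Taylor's formula and the expansion in coordinates that bounds the
  operator norm.
\<close>

lemma higher_deriv_slot_sum:
  assumes V: "subspace V"
    and diff: "\<And>hs. set hs \<subseteq> V \<Longrightarrow> length hs < k \<Longrightarrow> higher_deriv V F hs differentiable_on V"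
    and e: "e ` I \<subseteq> V"
    and "set gs \<subseteq> V" "set hs \<subseteq> V" "length gs + length hs < k" "x \<in> V"
  shows "higher_deriv V F (gs @ (\<Sum>i\<in>I. c i *\<^sub>R e i) # hs) x =
         (\<Sum>i\<in>I. c i *\<^sub>R higher_deriv V F (gs @ e i # hs) x)"
  using assms(4-7)
proof (induction gs arbitrary: x)
  case Nil
  then have "higher_deriv V F hs differentiable (at x within V)"
    using diff[of hs] by (auto simp: differentiable_on_def)
  from linear_frechet_derivative[OF this] show ?case
    by (simp add: linear_sum linear_scale)
next
  case (Cons g gs)
  define G where "G i = higher_deriv V F (gs @ e i # hs)" for i
  have G: "(G i has_derivative frechet_derivative (G i) (at x within V)) (at x within V)" if "i \<in> I" for i
    using diff[of "gs @ e i # hs"] Cons.prems e that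
    unfolding frechet_derivative_works[symmetric] G_def differentiable_on_def by auto
  have sum_deriv: "((\<lambda>x. \<Sum>i\<in>I. c i *\<^sub>R G i x) has_derivative
      (\<lambda>h. \<Sum>i\<in>I. c i *\<^sub>R frechet_derivative (G i) (at x within V) h)) (at x within V)"
    by (intro has_derivative_sum has_derivative_scaleR_right G)
  have slot: "higher_deriv V F (gs @ (\<Sum>i\<in>I. c i *\<^sub>R e i) # hs) x = (\<Sum>i\<in>I. c i *\<^sub>R G i x)"
    if "x \<in> V" for x
    using Cons that by (auto simp: G_def)
  have "(higher_deriv V F (gs @ (\<Sum>i\<in>I. c i *\<^sub>R e i) # hs) has_derivative
      (\<lambda>h. \<Sum>i\<in>I. c i *\<^sub>R frechet_derivative (G i) (at x within V) h)) (at x within V)"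
    by (rule has_derivative_transform[OF \<open>x \<in> V\<close> slot sum_deriv])
  from frechet_derivative_on_subspace[OF V _ _ this, of g] Cons.prems show ?case
    by (simp add: G_def)
qed

lemma higher_deriv_replicate_scale:
  assumes V: "subspace V"
    and diff: "\<And>hs. set hs \<subseteq> V \<Longrightarrow> length hs < k \<Longrightarrow> higher_deriv V F hs differentiable_on V"
    and e: "e \<in> V" "x \<in> V" and "j \<le> k"
  shows "higher_deriv V F (replicate j (c *\<^sub>R e)) x = c ^ j *\<^sub>R higher_deriv V F (replicate j e) x"
proof -
  have "higher_deriv V F (replicate i (c *\<^sub>R e) @ replicate m e) x =
        c ^ i *\<^sub>R higher_deriv V F (replicate (i + m) e) x" if "i + m \<le> k" for i m
    using that
  proof (induction i arbitrary: m)
    case (Suc i)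
    \<comment> \<open>The scaled copies stand in front, so the factor is pulled out of the last of them.\<close>
    have "higher_deriv V F (replicate (Suc i) (c *\<^sub>R e) @ replicate m e) x =
        higher_deriv V F (replicate i (c *\<^sub>R e) @ (c *\<^sub>R e) # replicate m e) x"
      by (metis append_Cons append_Nil append_assoc replicate_Suc replicate_append_same)
    also have "\<dots> = c *\<^sub>R higher_deriv V F (replicate i (c *\<^sub>R e) @ e # replicate m e) x"
      using higher_deriv_slot_sum[OF V diff, where k = k and I = "{()}" and e = "\<lambda>_. e" and c = "\<lambda>_. c"
          and gs = "replicate i (c *\<^sub>R e)" and hs = "replicate m e" and x = x] Suc.prems e V
      by (auto simp: subspace_scale set_replicate_conv_if)
    also have "\<dots> = c ^ Suc i *\<^sub>R higher_deriv V F (replicate (i + Suc m) e) x"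
      using Suc.IH[of "Suc m"] Suc.prems by simp
    finally show ?case by simp
  qed simp
  from this[of j 0] \<open>j \<le> k\<close> show ?thesis by simp
qed

text \<open>
  A finite-dimensional subspace, witnessed by finitely many vectors that reproduce each of its
  elements, such as an orthonormal basis. In this form the coefficients of a unit vector are bounded
  by the norms of the frame vectors.
\<close>

locale framed_subspace =
  fixes V B :: "'a::real_inner set"
  assumes subspace: "subspace V" and finite_frame: "finite B" and frame_subset: "B \<subseteq> V"
    and frame_expansion: "\<And>h. h \<in> V \<Longrightarrow> h = (\<Sum>b\<in>B. (h \<bullet> b) *\<^sub>R b)"
begin

text \<open>
  The operator norm is the supremum of a set of reals and carries information only if that set is
  bounded above. Expanding one argument after the other in the frame bounds it by the finitely many
  values on frame vectors; the prefix \<open>gs\<close> holds the arguments that are already expanded.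
\<close>

lemma higher_deriv_bounded:
  assumes diff: "\<And>hs. set hs \<subseteq> V \<Longrightarrow> length hs < k \<Longrightarrow> higher_deriv V F hs differentiable_on V"
    and x: "x \<in> V"
    and "set gs \<subseteq> V" "length gs + m = k"
  shows "\<exists>K. \<forall>hs. length hs = m \<longrightarrow> (\<forall>h\<in>set hs. h \<in> V \<and> norm h \<le> 1) \<longrightarrow>
           norm (higher_deriv V F (gs @ hs) x) \<le> K"
  using assms(3,4)
proof (induction m arbitrary: gs)
  case (Suc m)
  have "\<forall>b\<in>B. \<exists>K. \<forall>hs. length hs = m \<longrightarrow> (\<forall>h\<in>set hs. h \<in> V \<and> norm h \<le> 1) \<longrightarrow>
           norm (higher_deriv V F ((gs @ [b]) @ hs) x) \<le> K"
    using Suc frame_subset by (intro ballI Suc.IH) auto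
  then obtain K where K: "\<And>b hs. b \<in> B \<Longrightarrow> length hs = m \<Longrightarrow> (\<forall>h\<in>set hs. h \<in> V \<and> norm h \<le> 1) \<Longrightarrow>
           norm (higher_deriv V F (gs @ b # hs) x) \<le> K b"
    by (simp, metis)
  have "norm (higher_deriv V F (gs @ h # hs) x) \<le> (\<Sum>b\<in>B. norm b * K b)"
    if h: "h \<in> V" "norm h \<le> 1" and hs: "length hs = m" "\<forall>h\<in>set hs. h \<in> V \<and> norm h \<le> 1" for h hs
  proof -
    have "higher_deriv V F (gs @ h # hs) x = (\<Sum>b\<in>B. (h \<bullet> b) *\<^sub>R higher_deriv V F (gs @ b # hs) x)"
      using higher_deriv_slot_sum[OF subspace diff, where k = k and I = B and e = "\<lambda>b. b" and c = "\<lambda>b. h \<bullet> b"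
          and gs = gs and hs = hs and x = x] frame_expansion[OF h(1)] frame_subset Suc.prems hs x by auto
    also have "norm \<dots> \<le> (\<Sum>b\<in>B. norm b * K b)"
    proof (intro sum_norm_le)
      fix b assume b: "b \<in> B"
      have "\<bar>h \<bullet> b\<bar> \<le> norm h * norm b"
        by (rule Cauchy_Schwarz_ineq2)
      also have "\<dots> \<le> 1 * norm b"
        using h by (intro mult_right_mono) auto
      finally show "norm ((h \<bullet> b) *\<^sub>R higher_deriv V F (gs @ b # hs) x) \<le> norm b * K b"
        using K[OF b hs] by (auto intro!: mult_mono)
    qed
    finally show ?thesis .
  qed
  then show ?case
    by (intro exI[of _ "\<Sum>b\<in>B. norm b * K b"]) (auto simp: length_Suc_conv)
qed auto

lemma order_smooth_unit_direction:
  assumes smooth: "order_smooth k L V F" and x: "x \<in> V" "x' \<in> V" and e: "e \<in> V" "norm e \<le> 1"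
  shows "norm (higher_deriv V F (replicate k e) x - higher_deriv V F (replicate k e) x') \<le> L * norm (x - x')"
proof -
  define S where "S = {norm (higher_deriv V F hs x - higher_deriv V F hs x') | hs.
      length hs = k \<and> (\<forall>h\<in>set hs. h \<in> V \<and> norm h \<le> 1)}"
  have diff: "higher_deriv V F hs differentiable_on V" if "set hs \<subseteq> V" "length hs < k" for hs
    using smooth that by (auto simp: order_smooth_def times_cont_diff_on_def)
  obtain K where K: "\<And>hs. length hs = k \<Longrightarrow> \<forall>h\<in>set hs. h \<in> V \<and> norm h \<le> 1 \<Longrightarrow>
      norm (higher_deriv V F hs x) \<le> K"
    using higher_deriv_bounded[OF diff x(1), of k "[]" k] by auto
  obtain K' where K': "\<And>hs. length hs = k \<Longrightarrow> \<forall>h\<in>set hs. h \<in> V \<and> norm h \<le> 1 \<Longrightarrow>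
      norm (higher_deriv V F hs x') \<le> K'"
    using higher_deriv_bounded[OF diff x(2), of k "[]" k] by auto
  have "norm (higher_deriv V F (replicate k e) x - higher_deriv V F (replicate k e) x') \<le> Sup S"
  proof (rule cSup_upper)
    show "norm (higher_deriv V F (replicate k e) x - higher_deriv V F (replicate k e) x') \<in> S"
      using e by (force simp: S_def intro!: exI[of _ "replicate k e"])
    show "bdd_above S"
    proof (rule bdd_aboveI[of _ "K + K'"])
      fix s assume "s \<in> S"
      then obtain hs where hs: "length hs = k" "\<forall>h\<in>set hs. h \<in> V \<and> norm h \<le> 1"
        and s: "s = norm (higher_deriv V F hs x - higher_deriv V F hs x')"
        by (auto simp: S_def)
      show "s \<le> K + K'"
        unfolding s using norm_triangle_ineq4 add_mono[OF K[OF hs] K'[OF hs]] by (rule order_trans)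
    qed
  qed
  also have "\<dots> \<le> L * norm (x - x')"
    using smooth x by (simp add: order_smooth_def multi_onorm_def S_def)
  finally show ?thesis .
qed

end

section \<open>Taylor's formula\<close>

text \<open>
  Integrating the Lipschitz bound \<open>n\<close> times gives the constant \<open>L / (n + 1)!\<close>. The Lagrange form of
  the remainder would only give \<open>L / n!\<close>, which is too weak for the step sizes of the method.
\<close>

lemma taylor_remainder_bound:
  fixes f :: "nat \<Rightarrow> real \<Rightarrow> 'b::real_normed_vector"
  assumes "r \<ge> 0"
    and deriv: "\<And>j t. j < n \<Longrightarrow> (f j has_vector_derivative f (Suc j) t) (at t)"
    and lip: "\<And>t. 0 \<le> t \<Longrightarrow> norm (f n t - f n 0) \<le> L * t"
  shows "norm (f 0 r - (\<Sum>j\<le>n. (r ^ j / fact j) *\<^sub>R f j 0)) \<le> L * r ^ Suc n / fact (Suc n)"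
  using assms
proof (induction n arbitrary: f r)
  case 0
  then show ?case by simp
next
  case (Suc n)
  define g where "g t = f 0 t - (\<Sum>j\<le>Suc n. (t ^ j / fact j) *\<^sub>R f j 0)" for t
  define g' where "g' t = f 1 t - (\<Sum>j\<le>n. (t ^ j / fact j) *\<^sub>R f (Suc j) 0)" for t
  define \<phi> where "\<phi> t = L * t ^ Suc (Suc n) / fact (Suc (Suc n))" for t
  have IH: "norm (g' t) \<le> L * t ^ Suc n / fact (Suc n)" if "t \<ge> 0" for t
    using Suc.IH[of t "\<lambda>j. f (Suc j)"] Suc.prems that by (simp add: g'_def)
  have monomial: "((\<lambda>t. t ^ Suc j / fact (Suc j)) has_real_derivative t ^ j / fact j) (at t)" for t :: real and j
    using DERIV_cdivide[OF DERIV_pow[of "Suc j" t], of "fact (Suc j)"]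
    by (simp del: of_nat_Suc)
  have g_eq: "g t = f 0 t - f 0 0 - (\<Sum>j\<le>n. (t ^ Suc j / fact (Suc j)) *\<^sub>R f (Suc j) 0)" for t
    unfolding g_def sum.atMost_Suc_shift by simp
  have "((\<lambda>t. (t ^ Suc j / fact (Suc j)) *\<^sub>R f (Suc j) 0) has_vector_derivative
      (t ^ j / fact j) *\<^sub>R f (Suc j) 0) (at t)" for j t
    using has_vector_derivative_scaleR[OF monomial has_vector_derivative_const] by simp
  note sum_deriv = has_vector_derivative_sum[OF this]
  have dg: "(g has_vector_derivative g' t) (at t)" for t
    unfolding g_eq[abs_def] g'_def
    using has_vector_derivative_diff[OF has_vector_derivative_diff[OF Suc.prems(2)[of 0 t]
          has_vector_derivative_const] sum_deriv] by simp
  have d\<phi>: "(\<phi> has_vector_derivative L * t ^ Suc n / fact (Suc n)) (at t)" for t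
    using DERIV_cmult[OF monomial[of "Suc n" t], of L] unfolding \<phi>_def[abs_def]
    by (simp add: has_real_derivative_iff_has_vector_derivative del: fact_Suc)
  have "norm (g r - g 0) \<le> \<phi> r - \<phi> 0"
  proof (cases "r = 0")
    case False
    show ?thesis
    proof (rule differentiable_bound_general[OF _ _ _ dg d\<phi>])
      show "continuous_on {0..r} g" "continuous_on {0..r} \<phi>"
        by (auto intro!: continuous_at_imp_continuous_on has_vector_derivative_continuous[OF dg]
            has_vector_derivative_continuous[OF d\<phi>])
    qed (use False Suc.prems IH in auto)
  qed simp
  moreover have "g 0 = 0" "\<phi> 0 = 0"
    by (simp_all add: g_eq \<phi>_def)
  ultimately show ?case
    by (simp add: g_def \<phi>_def)
qed

context framed_subspace
begin

lemma order_smooth_taylor_unit: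
  assumes smooth: "order_smooth k L V F" and V: "v \<in> V" "e \<in> V" "norm e = 1" and "r \<ge> 0"
  shows "norm (F (v + r *\<^sub>R e) - (\<Sum>j\<le>k. (r ^ j / fact j) *\<^sub>R higher_deriv V F (replicate j e) v))
         \<le> L * r ^ Suc k / fact (Suc k)"
proof -
  define f where "f j t = higher_deriv V F (replicate j e) (v + t *\<^sub>R e)" for j t
  have line: "v + t *\<^sub>R e \<in> V" for t
    using V subspace by (simp add: subspace_add subspace_scale)
  have "(f j has_vector_derivative f (Suc j) t) (at t)" if "j < k" for j t
  proof -
    have "higher_deriv V F (replicate j e) differentiable (at (v + t *\<^sub>R e) within V)"
      using smooth line that V
      by (auto simp: order_smooth_def times_cont_diff_on_def differentiable_on_def set_replicate_conv_if)
    from has_vector_derivative_along_line[OF subspace V(1,2) this[unfolded frechet_derivative_works]]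
    show ?thesis
      by (simp add: f_def[abs_def])
  qed
  moreover have "norm (f k t - f k 0) \<le> L * t" if "t \<ge> 0" for t
    using order_smooth_unit_direction[OF smooth line line, of e t 0] V that by (simp add: f_def)
  ultimately show ?thesis
    using taylor_remainder_bound[OF \<open>r \<ge> 0\<close>, of k f L] by (simp add: f_def)
qed

text \<open>
  The case of a unit direction, rescaled by homogeneity of the higher derivatives.
\<close>

lemma order_smooth_taylor:
  assumes smooth: "order_smooth k L V F" and V: "v \<in> V" "x \<in> V"
  shows "norm (F x - (\<Sum>j\<le>k. (1 / fact j) *\<^sub>R higher_deriv V F (replicate j (x - v)) v))
         \<le> L * norm (x - v) ^ Suc k / fact (Suc k)"
proof -
  have diff: "higher_deriv V F hs differentiable_on V" if "set hs \<subseteq> V" "length hs < k" for hs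
    using smooth that by (auto simp: order_smooth_def times_cont_diff_on_def)
  define r where "r = norm (x - v)"
  show ?thesis
  proof (cases "x = v")
    case True
    have "higher_deriv V F (replicate j (0::'a)) v = (if j = 0 then F v else 0)" if "j \<le> k" for j
      using higher_deriv_replicate_scale[OF subspace diff, of k v v j 0] V that by auto
    then have "(\<Sum>j\<le>k. (1 / fact j) *\<^sub>R higher_deriv V F (replicate j (0::'a)) v) =
        (\<Sum>j\<le>k. if j = 0 then F v else 0)"
      by (intro sum.cong) auto
    with True show ?thesis by simp
  next
    case False
    define e where "e = (1 / r) *\<^sub>R (x - v)"
    have e: "e \<in> V" "norm e = 1" "x - v = r *\<^sub>R e" "r \<ge> 0" and x: "x = v + r *\<^sub>R e"
      using V False subspace by (auto simp: e_def r_def subspace_diff subspace_scale)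
    have "higher_deriv V F (replicate j (x - v)) v = r ^ j *\<^sub>R higher_deriv V F (replicate j e) v"
      if "j \<le> k" for j
      using higher_deriv_replicate_scale[OF subspace diff e(1) V(1) that] e by simp
    then show ?thesis
      using order_smooth_taylor_unit[OF smooth V(1) e(1,2,4)] x
      by (simp add: r_def[symmetric] e(2,4))
  qed
qed

end

context framed_subspace
begin

text \<open>
  Both hypotheses concern the whole space, so they can be compared at infinity. Along the ray through
  \<open>e\<close> the increment \<open>F (r e) - F 0\<close> has norm at least \<open>\<mu> r\<^bsup>k+1\<^esup>\<close> by monotonicity and at most
  \<open>L r\<^bsup>k+1\<^esup> / (k+1)! + K r\<^sup>k\<close> by Taylor's formula at \<open>0\<close>; divide by \<open>r\<^bsup>k+1\<^esup>\<close> and let \<open>r\<close> grow.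
\<close>

lemma smoothness_dominates_monotonicity:
  assumes smooth: "order_smooth k L V F" and mono: "order_uniformly_monotone (Suc k) \<mu> V F"
    and e: "e \<in> V" "norm e = 1" and "L \<ge> 0"
  shows "\<mu> \<le> L / fact (Suc k)"
proof -
  define b where "b j = norm (higher_deriv V F (replicate j e) 0)" for j
  define K where "K = (\<Sum>j\<le>k. b j / fact j) + norm (F 0)"
  have V0: "0 \<in> V"
    using subspace by (rule subspace_0)
  have bound: "\<mu> \<le> L / fact (Suc k) + K / r" if r: "r \<ge> 1" for r :: real
  proof -
    let ?T = "\<Sum>j\<le>k. (r ^ j / fact j) *\<^sub>R higher_deriv V F (replicate j e) 0"
    have "r * (\<mu> * r ^ Suc k) = \<mu> * norm (r *\<^sub>R e - 0) ^ (Suc k + 1)"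
      using r e by simp
    also have "\<dots> \<le> (F (r *\<^sub>R e) - F 0) \<bullet> (r *\<^sub>R e - 0)"
      using mono V0 subspace_scale[OF subspace e(1), of r] unfolding order_uniformly_monotone_def by blast
    also have "\<dots> \<le> norm (F (r *\<^sub>R e) - F 0) * norm (r *\<^sub>R e - 0)"
      by (rule norm_cauchy_schwarz)
    also have "\<dots> = r * norm (F (r *\<^sub>R e) - F 0)"
      using r e by simp
    finally have "\<mu> * r ^ Suc k \<le> norm (F (r *\<^sub>R e) - F 0)"
      using r mult_le_cancel_left_pos[of r] by (simp del: power_Suc)
    also have "\<dots> \<le> norm (F (r *\<^sub>R e) - ?T) + (norm ?T + norm (F 0))"
      using norm_triangle_ineq[of "F (r *\<^sub>R e) - ?T" "?T - F 0"] norm_triangle_ineq4[of ?T "F 0"] by simp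
    also have "norm (F (r *\<^sub>R e) - ?T) \<le> L * r ^ Suc k / fact (Suc k)"
      using order_smooth_taylor_unit[OF smooth V0 e, of r] r by simp
    also have "norm ?T + norm (F 0) \<le> K * r ^ k"
    proof -
      have "norm ?T \<le> (\<Sum>j\<le>k. b j / fact j * r ^ k)"
      proof (rule sum_norm_le)
        fix j assume "j \<in> {..k}"
        then have "r ^ j * b j \<le> r ^ k * b j"
          using r by (intro mult_right_mono power_increasing) (auto simp: b_def)
        then show "norm ((r ^ j / fact j) *\<^sub>R higher_deriv V F (replicate j e) 0) \<le> b j / fact j * r ^ k"
          using r by (simp add: b_def divide_right_mono mult.commute)
      qed
      moreover have "norm (F 0) * 1 \<le> norm (F 0) * r ^ k"
        using r by (intro mult_left_mono) auto
      ultimately show ?thesis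
        by (simp add: K_def sum_distrib_right distrib_right)
    qed
    finally have "\<mu> * r ^ Suc k \<le> (L / fact (Suc k) + K / r) * r ^ Suc k"
      using r by (simp add: distrib_right)
    then show ?thesis
      using r mult_le_cancel_right_pos[of "r ^ Suc k"] by (simp del: power_Suc)
  qed
  have "(\<lambda>n. L / fact (Suc k) + K / real n) \<longlonglongrightarrow> L / fact (Suc k) + 0"
    by (intro tendsto_intros lim_const_over_n)
  then have "(\<lambda>n. L / fact (Suc k) + K / real n) \<longlonglongrightarrow> L / fact (Suc k)"
    by simp
  then show ?thesis
    by (rule LIMSEQ_le_const) (use bound in \<open>auto intro!: exI[of _ 1]\<close>)
qed

end

section \<open>Two convexity inequalities\<close>

text \<open>
  Jensen's inequality for the convex function \<open>t \<mapsto> t\<^bsup>-n/2\<^esup>\<close> at the points \<open>(a\<^sub>i)\<^sup>2\<close>, proved by adding up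
  tangents: when \<open>a\<^sub>i\<close> is measured in units of \<open>M\<close>, the tangent at \<open>1\<close> is \<open>1 - n/2 (t - 1)\<close>, and the
  hypothesis on the squares says that the linear parts have a nonnegative sum.
\<close>

lemma sum_inverse_power_ge:
  fixes a :: "nat \<Rightarrow> real"
  assumes "M > 0" and sq: "(\<Sum>i<T. (a i)\<^sup>2) \<le> real T * M\<^sup>2"
    and pos: "\<And>i. i < T \<Longrightarrow> n = 0 \<or> a i > 0"
  shows "real T / M ^ n \<le> (\<Sum>i<T. 1 / a i ^ n)"
proof -
  have tangent: "1 - real n / 2 * ((a i / M)\<^sup>2 - 1) \<le> 1 / (a i / M) ^ n" if i: "i < T" for i
  proof (cases "n = 0")
    case False
    define u where "u = a i / M"
    have u: "u > 0"
      using pos[OF i] False \<open>M > 0\<close> by (simp add: u_def)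
    have "2 * ln u \<le> u\<^sup>2 - 1"
      using ln_le_minus_one[of "u\<^sup>2"] u by (simp add: ln_realpow)
    then have "real n / 2 * (2 * ln u) \<le> real n / 2 * (u\<^sup>2 - 1)"
      by (intro mult_left_mono) auto
    then have "1 - real n / 2 * (u\<^sup>2 - 1) \<le> 1 + - (real n * ln u)"
      by simp
    also have "\<dots> \<le> exp (- (real n * ln u))"
      by (rule exp_ge_add_one_self)
    also have "\<dots> = 1 / u ^ n"
      using u by (simp add: exp_minus exp_of_nat_mult inverse_eq_divide)
    finally show ?thesis
      by (simp add: u_def)
  qed simp
  have "(\<Sum>i<T. (a i / M)\<^sup>2) \<le> real T"
    using sq \<open>M > 0\<close> by (simp add: power_divide sum_divide_distrib[symmetric] divide_le_eq)
  then have "real n / 2 * ((\<Sum>i<T. (a i / M)\<^sup>2) - real T) \<le> 0"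
    by (intro mult_nonneg_nonpos) auto
  then have "real T \<le> (\<Sum>i<T. 1 - real n / 2 * ((a i / M)\<^sup>2 - 1))"
    by (simp add: sum_subtractf sum_distrib_left[symmetric] sum_divide_distrib[symmetric])
  also have "\<dots> \<le> (\<Sum>i<T. 1 / (a i / M) ^ n)"
    using tangent by (intro sum_mono) auto
  also have "\<dots> = M ^ n * (\<Sum>i<T. 1 / a i ^ n)"
    by (simp add: power_divide sum_distrib_left)
  finally show ?thesis
    using \<open>M > 0\<close> by (simp add: divide_le_eq mult.commute)
qed

lemma norm_weighted_average_power_le:
  fixes y :: "nat \<Rightarrow> 'a::real_normed_vector"
  assumes l: "\<And>i. i < k \<Longrightarrow> l i \<ge> 0" and \<Lambda>: "\<Lambda> = (\<Sum>i<k. l i)" "\<Lambda> > 0"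
  shows "\<Lambda> * norm ((1 / \<Lambda>) *\<^sub>R (\<Sum>i<k. l i *\<^sub>R y i) - z) ^ n \<le> (\<Sum>i<k. l i * norm (y i - z) ^ n)"
proof -
  define c where "c i = l i / \<Lambda>" for i
  have c: "c i \<ge> 0" if "i < k" for i
    using l[OF that] \<Lambda> by (simp add: c_def)
  have sum_c: "(\<Sum>i<k. c i) = 1"
    using \<Lambda> by (simp add: c_def sum_divide_distrib[symmetric])
  have "(1 / \<Lambda>) *\<^sub>R (\<Sum>i<k. l i *\<^sub>R y i) - z = (\<Sum>i<k. c i *\<^sub>R y i) - (\<Sum>i<k. c i) *\<^sub>R z"
    by (simp add: sum_c) (simp add: c_def scaleR_sum_right)
  also have "\<dots> = (\<Sum>i<k. c i *\<^sub>R (y i - z))"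
    by (simp add: scaleR_diff_right sum_subtractf scaleR_sum_left)
  finally have "norm ((1 / \<Lambda>) *\<^sub>R (\<Sum>i<k. l i *\<^sub>R y i) - z) \<le> (\<Sum>i<k. c i * norm (y i - z))"
    using c by (auto intro!: sum_norm_le)
  then have "norm ((1 / \<Lambda>) *\<^sub>R (\<Sum>i<k. l i *\<^sub>R y i) - z) ^ n \<le> (\<Sum>i<k. c i *\<^sub>R norm (y i - z)) ^ n"
    by (intro power_mono) auto
  also have "\<dots> \<le> (\<Sum>i<k. c i * norm (y i - z) ^ n)"
  proof (rule convex_on_sum)
    show "convex_on {0::real..} (\<lambda>x. x ^ n)"
      by (cases "even n")
        (auto intro: convex_power_odd convex_on_subset[OF convex_power_even])
    show "{..<k} \<noteq> {}"
      using sum_c by auto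
  qed (use c sum_c in auto)
  finally have "norm ((1 / \<Lambda>) *\<^sub>R (\<Sum>i<k. l i *\<^sub>R y i) - z) ^ n \<le> (\<Sum>i<k. l i * norm (y i - z) ^ n) / \<Lambda>"
    by (simp add: c_def sum_divide_distrib)
  then show ?thesis
    using \<Lambda>(2) by (simp add: le_divide_eq mult.commute)
qed

section \<open>Variational inequalities\<close>

lemma vi_solution_unique:
  assumes "order_uniformly_monotone p \<mu> V F" "\<mu> > 0" "X \<subseteq> V" "vi_solution X F x" "vi_solution X F z"
  shows "x = z"
proof -
  have "\<mu> * norm (x - z) ^ (p + 1) \<le> (F x - F z) \<bullet> (x - z)"
    using assms by (auto simp: order_uniformly_monotone_def vi_solution_def)
  also have "\<dots> = - (F x \<bullet> (z - x)) - F z \<bullet> (x - z)"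
    by (simp add: inner_diff_left inner_diff_right)
  also have "\<dots> \<le> 0"
  proof -
    have "F x \<bullet> (z - x) \<ge> 0" "F z \<bullet> (x - z) \<ge> 0"
      using assms(4,5) by (auto simp: vi_solution_def)
    then show ?thesis
      by linarith
  qed
  finally show ?thesis
    using \<open>\<mu> > 0\<close> by (metis mult_pos_pos zero_less_power zero_less_norm_iff not_less right_minus_eq)
qed

text \<open>
  Minty's argument: the weak inequality at points of the segment from \<open>z\<close> to \<open>x\<close> has the fixed
  direction \<open>x - z\<close> up to a positive factor, and the points may tend to \<open>z\<close>.
\<close>

lemma weak_vi_solution_imp_vi_solution:
  assumes cont: "continuous_on X F" and "convex X" and weak: "weak_vi_solution X F z"
  shows "vi_solution X F z"
  unfolding vi_solution_def
proof (intro conjI ballI)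
  show z: "z \<in> X"
    using weak by (simp add: weak_vi_solution_def)
  fix x assume x: "x \<in> X"
  define u where "u n = z + (1 / real (Suc n)) *\<^sub>R (x - z)" for n
  have u: "u n \<in> X" for n
  proof -
    have "(1 - 1 / real (Suc n)) *\<^sub>R z + (1 / real (Suc n)) *\<^sub>R x \<in> X"
      using \<open>convex X\<close> z x by (intro convexD_alt) auto
    then show ?thesis
      by (simp add: u_def algebra_simps)
  qed
  have "(\<lambda>n. z + (1 / real (Suc n)) *\<^sub>R (x - z)) \<longlonglongrightarrow> z + 0 *\<^sub>R (x - z)"
    using LIMSEQ_inverse_real_of_nat by (intro tendsto_intros) (simp add: inverse_eq_divide)
  then have "u \<longlonglongrightarrow> z"
    by (simp add: u_def[abs_def])
  then have "(\<lambda>n. F (u n)) \<longlonglongrightarrow> F z"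
    using continuous_on_tendsto_compose[OF cont _ z, of u sequentially] u by simp
  then have lim: "(\<lambda>n. F (u n) \<bullet> (x - z)) \<longlonglongrightarrow> F z \<bullet> (x - z)"
    by (intro tendsto_intros)
  have "F (u n) \<bullet> (x - z) \<ge> 0" for n
  proof -
    have "0 \<le> F (u n) \<bullet> (u n - z)"
      using weak u by (simp add: weak_vi_solution_def)
    then show ?thesis
      by (simp add: u_def zero_le_divide_iff)
  qed
  then show "F z \<bullet> (x - z) \<ge> 0"
    by (intro LIMSEQ_le_const[OF lim]) auto
qed

text \<open>
  The objective is a parabola along the segment from the maximiser \<open>v\<close> to \<open>u\<close>. Its slope at \<open>v\<close>
  cannot be positive, and what remains is the curvature term.
\<close>

lemma dual_step_strong_concavity:
  assumes "convex X" and v: "dual_step X x0 s v" and u: "u \<in> X"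
  shows "s \<bullet> (u - x0) - 1 / 2 * (norm (u - x0))\<^sup>2
         \<le> s \<bullet> (v - x0) - 1 / 2 * (norm (v - x0))\<^sup>2 - 1 / 2 * (norm (u - v))\<^sup>2"
proof -
  define g where "g u = s \<bullet> (u - x0) - 1 / 2 * (norm (u - x0))\<^sup>2" for u
  define A where "A = s \<bullet> (u - v) - (v - x0) \<bullet> (u - v)"
  define N where "N = (norm (u - v))\<^sup>2"
  have vX: "v \<in> X" and max: "g w \<le> g v" if "w \<in> X" for w
    using v that by (auto simp: dual_step_def is_arg_max_linorder g_def)
  have expand: "g (v + t *\<^sub>R (u - v)) = g v + t * A - t\<^sup>2 / 2 * N" for t
    unfolding g_def A_def N_def power2_norm_eq_inner
    by (simp add: algebra_simps inner_commute power2_eq_square)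
  have slope: "A \<le> t / 2 * N" if t: "0 < t" "t \<le> 1" for t
  proof -
    have "(1 - t) *\<^sub>R v + t *\<^sub>R u \<in> X"
      using \<open>convex X\<close> vX u t by (intro convexD_alt) auto
    then have "v + t *\<^sub>R (u - v) \<in> X"
      by (simp add: algebra_simps)
    from max[OF this] have "t * A \<le> t * (t / 2 * N)"
      unfolding expand by (simp add: power2_eq_square)
    then show ?thesis
      using t by simp
  qed
  have "A \<le> 0"
  proof (rule ccontr)
    assume "\<not> A \<le> 0"
    moreover have "N \<ge> 0"
      by (simp add: N_def)
    moreover have "A \<le> 1 / 2 * N"
      using slope[of 1] by simp
    ultimately have "0 < A" "A \<le> N" "N > 0"
      by auto
    then show False
      \<comment> \<open>At \<open>t = A / N \<le> 1\<close> the bound on the slope reads \<open>A \<le> A / 2\<close>.\<close>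
      using slope[of "A / N"] by simp
  qed
  then show ?thesis
    using expand[of 1] by (simp add: g_def N_def)
qed

section \<open>One run of the inner method\<close>

text \<open>
  The relation \<open>perseus_state\<close> remembers only sums, while the analysis needs every iterate. Here
  \<open>v i\<close>, \<open>y i\<close>, \<open>l i\<close> are the dual point, the answer of the solver and the step size of iteration
  \<open>i + 1\<close>, and the dual vector is expressed through the earlier ones.
\<close>

definition perseus_run ::
    "'a::real_inner set \<Rightarrow> 'a set \<Rightarrow> ('a \<Rightarrow> 'a) \<Rightarrow> nat \<Rightarrow> 'a \<Rightarrow> real \<Rightarrow>
     nat \<Rightarrow> (nat \<Rightarrow> 'a) \<Rightarrow> (nat \<Rightarrow> 'a) \<Rightarrow> (nat \<Rightarrow> real) \<Rightarrow> bool" where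
  "perseus_run V X F p x0 L k v y l \<longleftrightarrow>
     (\<forall>i<k. dual_step X x0 (- (\<Sum>j<i. l j *\<^sub>R F (y j))) (v i) \<and>
            subproblem_answer V X F p L (v i) (y i) \<and> \<not> (p \<ge> 2 \<and> y i = v i) \<and>
            step_size p L (v i) (y i) (l i))"

lemma perseus_state_imp_run:
  assumes "perseus_state V X F p x0 L T k x s \<Lambda> w"
  shows "\<exists>v y l. perseus_run V X F p x0 L k v y l \<and> s = - (\<Sum>i<k. l i *\<^sub>R F (y i)) \<and>
           \<Lambda> = (\<Sum>i<k. l i) \<and> w = (\<Sum>i<k. l i *\<^sub>R y i)"
  using assms
proof induction
  case init
  then show ?case by (simp add: perseus_run_def)
next
  case (step k x s \<Lambda> w v' y' l')
  then obtain v y l where run: "perseus_run V X F p x0 L k v y l"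
    and sums: "s = - (\<Sum>i<k. l i *\<^sub>R F (y i))" "\<Lambda> = (\<Sum>i<k. l i)" "w = (\<Sum>i<k. l i *\<^sub>R y i)"
    by blast
  have run': "perseus_run V X F p x0 L (Suc k) (v(k := v')) (y(k := y')) (l(k := l'))"
    unfolding perseus_run_def
  proof (intro allI impI)
    fix i assume i: "i < Suc k"
    have prefix: "(\<Sum>j<i. (l(k := l')) j *\<^sub>R F ((y(k := y')) j)) = (\<Sum>j<i. l j *\<^sub>R F (y j))"
      using i by (intro sum.cong) auto
    show "dual_step X x0 (- (\<Sum>j<i. (l(k := l')) j *\<^sub>R F ((y(k := y')) j))) ((v(k := v')) i) \<and>
            subproblem_answer V X F p L ((v(k := v')) i) ((y(k := y')) i) \<and>
            \<not> (p \<ge> 2 \<and> (y(k := y')) i = (v(k := v')) i) \<and>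
            step_size p L ((v(k := v')) i) ((y(k := y')) i) ((l(k := l')) i)"
      unfolding prefix using run step.hyps sums(1) i by (cases "i = k") (auto simp: perseus_run_def)
  qed
  have prefix: "(\<Sum>i<k. (l(k := l')) i *\<^sub>R F ((y(k := y')) i)) = (\<Sum>i<k. l i *\<^sub>R F (y i))"
    "(\<Sum>i<k. (l(k := l')) i) = (\<Sum>i<k. l i)"
    "(\<Sum>i<k. (l(k := l')) i *\<^sub>R (y(k := y')) i) = (\<Sum>i<k. l i *\<^sub>R y i)"
    by (auto intro!: sum.cong)
  show ?case
  proof (intro exI conjI)
    show "perseus_run V X F p x0 L (Suc k) (v(k := v')) (y(k := y')) (l(k := l'))"
      by (rule run')
  qed (simp_all add: prefix sums del: fun_upd_apply add: fun_upd_same)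
qed

locale perseus_problem = framed_subspace V B
  for V B :: "'a::real_inner set" +
  fixes X :: "'a set" and F :: "'a \<Rightarrow> 'a" and p :: nat and L \<mu> :: real and z :: 'a
  assumes p: "p \<ge> 1" and L: "L > 0" and \<mu>: "\<mu> > 0"
    and X: "X \<subseteq> V" "convex X" "bounded X"
    and smooth: "order_smooth (p - 1) L V F"
    and monotone: "order_uniformly_monotone p \<mu> V F"
    and weak_solution: "weak_vi_solution X F z"
begin

lemma differentiable_higher_deriv:
  assumes "set hs \<subseteq> V" "length hs < p - 1"
  shows "higher_deriv V F hs differentiable_on V"
  using smooth assms by (auto simp: order_smooth_def times_cont_diff_on_def)

lemma continuous_on_operator: "continuous_on V F"
proof (cases "p = 1")
  case True
  then show ?thesis
    using smooth by (simp add: order_smooth_def times_cont_diff_on_def)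
next
  case False
  then show ?thesis
    using differentiable_higher_deriv[of "[]"] p by (auto intro: differentiable_imp_continuous_on)
qed

lemma solution: "vi_solution X F z"
  using weak_vi_solution_imp_vi_solution continuous_on_subset[OF continuous_on_operator X(1)]
    X(2) weak_solution by blast

lemma solution_in: "z \<in> X"
  using weak_solution by (simp add: weak_vi_solution_def)

lemma solution_unique: "vi_solution X F x \<Longrightarrow> x = z"
  using vi_solution_unique[OF monotone \<mu> X(1) _ solution] .

lemma monotone_at_solution:
  assumes "x \<in> X"
  shows "\<mu> * norm (x - z) ^ (p + 1) \<le> F x \<bullet> (x - z)"
proof -
  have "\<mu> * norm (x - z) ^ (p + 1) \<le> (F x - F z) \<bullet> (x - z)"
    using monotone assms solution_in X(1) unfolding order_uniformly_monotone_def by blast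
  moreover have "F z \<bullet> (x - z) \<ge> 0"
    using solution assms by (simp add: vi_solution_def)
  ultimately show ?thesis
    by (simp add: inner_diff_left)
qed

lemma subproblem_answerD:
  assumes "subproblem_answer V X F p L v y"
  shows "y \<in> X"
    and "u \<in> X \<Longrightarrow> reg_taylor V F p L v y \<bullet> (y - u) \<le> L / fact p * norm (y - v) ^ (p + 1)"
proof -
  show y: "y \<in> X"
    using assms by (simp add: subproblem_answer_def)
  assume u: "u \<in> X"
  obtain K where K: "\<And>x. x \<in> X \<Longrightarrow> norm x \<le> K"
    using X(3) by (auto simp: bounded_iff)
  have "bdd_above ((\<lambda>x. reg_taylor V F p L v y \<bullet> (y - x)) ` X)"
  proof (rule bdd_aboveI2)
    fix x assume x: "x \<in> X"
    have "norm (y - x) \<le> K + K"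
      using norm_triangle_ineq4[of y x] K[OF x] K[OF y] by simp
    then show "reg_taylor V F p L v y \<bullet> (y - x) \<le> norm (reg_taylor V F p L v y) * (K + K)"
      using norm_cauchy_schwarz[of "reg_taylor V F p L v y" "y - x"]
        mult_left_mono[of "norm (y - x)" "K + K" "norm (reg_taylor V F p L v y)"] by simp
  qed
  from cSUP_upper[OF u this] assms
  show "reg_taylor V F p L v y \<bullet> (y - u) \<le> L / fact p * norm (y - v) ^ (p + 1)"
    by (simp add: subproblem_answer_def)
qed

lemma taylor_model_error:
  assumes "v \<in> V" "x \<in> V"
  shows "norm (F x - (reg_taylor V F p L v x - (5 * L / fact (p - 1) * norm (x - v) ^ (p - 1)) *\<^sub>R (x - v)))
         \<le> L / fact p * norm (x - v) ^ p"
proof -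
  obtain k where "p = Suc k"
    using p by (cases p) auto
  then show ?thesis
    using order_smooth_taylor[OF smooth assms] by (simp add: reg_taylor_def lessThan_Suc_atMost)
qed

text \<open>
  At its centre the model coincides with \<open>F\<close>, so a zero tolerance in the subproblem is exactly the
  variational inequality.
\<close>

lemma fixpoint_is_solution:
  assumes "p \<ge> 2" "v \<in> V" "subproblem_answer V X F p L v v"
  shows "vi_solution X F v"
proof -
  have "F v = reg_taylor V F p L v v"
    using taylor_model_error[OF assms(2,2)] p by (simp add: zero_power)
  then show ?thesis
    using subproblem_answerD[OF assms(3)] p
    by (auto simp: vi_solution_def zero_power inner_diff_right)
qed

text \<open>
  Let \<open>a\<close> and \<open>b\<close> be the distances of \<open>y\<close> and \<open>u\<close> from \<open>v\<close>, and \<open>\<theta> = l L a\<^sup>p\<^sup>-\<^sup>1 / p!\<close>.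
  The Taylor error costs \<open>\<theta> a (a + b)\<close>, the tolerance of the subproblem \<open>\<theta> a\<^sup>2\<close>, and the
  regularisation gains \<open>5 p \<theta> (a\<^sup>2 - a b)\<close>, since \<open>5 L / (p-1)! = 5 p L / p!\<close>. Altogether this is
  \<open>(5 p + 1) \<theta> a b - (5 p - 2) \<theta> a\<^sup>2\<close>. The two bounds on the step size are those that make it at
  most \<open>a b / 2 - a\<^sup>2 / 4\<close>, and \<open>a b / 2\<close> is absorbed by \<open>b\<^sup>2 / 2\<close> and half of \<open>a\<^sup>2 / 4\<close>.
\<close>

lemma step_estimate:
  assumes v: "v \<in> X" and u: "u \<in> X"
    and y: "subproblem_answer V X F p L v y" and l: "step_size p L v y l"
  shows "l * (F y \<bullet> (y - u)) - 1 / 2 * (norm (u - v))\<^sup>2 \<le> - 1 / 8 * (norm (y - v))\<^sup>2"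
proof -
  define a b q \<theta> where "a = norm (y - v)" and "b = norm (u - v)"
    and "q = L / fact p * a ^ (p - 1)" and "\<theta> = l * q"
  define P where "P = real p"
  define c where "c = 5 * L / fact (p - 1) * a ^ (p - 1)"
  define M where "M = reg_taylor V F p L v y"
  have nonneg: "a \<ge> 0" "b \<ge> 0" "q \<ge> 0" and P: "P \<ge> 1"
    using L p by (auto simp: a_def b_def q_def P_def)
  have fact_p: "fact p = P * (fact (p - 1) :: real)"
    using p by (simp add: P_def fact_reduce)
  have c: "c = 5 * P * q"
    using P by (simp add: c_def q_def fact_p)
  have yX: "y \<in> X"
    using subproblem_answerD(1)[OF y] .
  have pow: "a ^ p = a * a ^ (p - 1)"
    using p by (cases p) auto
  have yu: "norm (y - u) \<le> a + b"
    using norm_triangle_ineq4[of "y - v" "u - v"] by (simp add: a_def b_def)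
  have "norm (F y - (M - c *\<^sub>R (y - v))) \<le> L / fact p * a ^ p"
    using taylor_model_error[of v y] v yX X(1) by (auto simp: M_def c_def a_def)
  also have "\<dots> = q * a"
    by (simp add: q_def pow)
  finally have "norm (F y - (M - c *\<^sub>R (y - v))) * norm (y - u) \<le> (q * a) * (a + b)"
    using yu nonneg by (intro mult_mono) auto
  then have model: "(F y - (M - c *\<^sub>R (y - v))) \<bullet> (y - u) \<le> (q * a) * (a + b)"
    using norm_cauchy_schwarz[of "F y - (M - c *\<^sub>R (y - v))" "y - u"] by linarith
  have sub: "M \<bullet> (y - u) \<le> q * a\<^sup>2"
    using subproblem_answerD(2)[OF y u] by (simp add: M_def q_def a_def[symmetric] pow power2_eq_square mult_ac)
  have "(y - v) \<bullet> (y - u) = a\<^sup>2 - (y - v) \<bullet> (u - v)"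
    by (simp add: a_def power2_norm_eq_inner inner_diff_right)
  moreover have "(y - v) \<bullet> (u - v) \<le> a * b"
    unfolding a_def b_def by (rule norm_cauchy_schwarz)
  ultimately have "c * (a\<^sup>2 - a * b) \<le> c * ((y - v) \<bullet> (y - u))"
    using nonneg P c by (intro mult_left_mono) auto
  then have "F y \<bullet> (y - u) \<le> (q * a) * (a + b) + q * a\<^sup>2 - c * (a\<^sup>2 - a * b)"
    using model sub by (simp add: inner_diff_left)
  also have "\<dots> = q * ((5 * P + 1) * (a * b) - (5 * P - 2) * a\<^sup>2)"
    by (simp add: c power2_eq_square algebra_simps)
  finally have "l * (F y \<bullet> (y - u)) \<le> l * (q * ((5 * P + 1) * (a * b) - (5 * P - 2) * a\<^sup>2))"
    using l by (intro mult_left_mono) (auto simp: step_size_def)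
  also have "\<dots> = ((5 * P + 1) * \<theta>) * (a * b) - ((5 * P - 2) * \<theta>) * a\<^sup>2"
    by (simp add: \<theta>_def algebra_simps)
  also have "\<dots> \<le> 1 / 2 * (a * b) - 1 / 4 * a\<^sup>2"
  proof -
    have "1 / (20 * P - 8) \<le> \<theta>" "\<theta> \<le> 1 / (10 * P + 2)"
      using l by (simp_all add: step_size_def \<theta>_def q_def a_def P_def mult.assoc)
    then have "1 / 4 \<le> (5 * P - 2) * \<theta>" "(5 * P + 1) * \<theta> \<le> 1 / 2"
      using P by (simp_all add: field_simps)
    then show ?thesis
      using nonneg by (intro diff_mono mult_right_mono) auto
  qed
  finally have "l * (F y \<bullet> (y - u)) \<le> 1 / 2 * (a * b) - 1 / 4 * a\<^sup>2" .
  moreover have "1 / 2 * (a * b) \<le> 1 / 8 * a\<^sup>2 + 1 / 2 * b\<^sup>2"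
    using zero_le_power2[of "a - 2 * b"] by (simp add: power2_eq_square algebra_simps)
  ultimately show ?thesis
    unfolding a_def b_def by linarith
qed

text \<open>
  The first two terms are the dual objective at \<open>u\<close>. Bounding it at every \<open>u\<close> of \<open>X\<close>, which amounts to
  bounding its maximum, gives an inductive statement: the induction hypothesis is used at the next
  dual point \<open>v k\<close>, and passing from there to \<open>u\<close> gains the curvature term that \<open>step_estimate\<close>
  consumes.
\<close>

lemma perseus_run_potential:
  assumes "perseus_run V X F p x0 L k v y l" and "u \<in> X"
  shows "- (\<Sum>i<k. l i *\<^sub>R F (y i)) \<bullet> (u - x0) - 1 / 2 * (norm (u - x0))\<^sup>2
         + (\<Sum>i<k. l i * (F (y i) \<bullet> (y i - x0))) + 1 / 8 * (\<Sum>i<k. (norm (y i - v i))\<^sup>2) \<le> 0"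
  using assms
proof (induction k arbitrary: u)
  case (Suc k)
  define s where "s = - (\<Sum>i<k. l i *\<^sub>R F (y i))"
  have step: "dual_step X x0 s (v k)" "subproblem_answer V X F p L (v k) (y k)" "step_size p L (v k) (y k) (l k)"
    and run: "perseus_run V X F p x0 L k v y l"
    using Suc.prems by (auto simp: perseus_run_def s_def)
  have vX: "v k \<in> X"
    using step(1) by (auto simp: dual_step_def is_arg_max_def)
  define E S A where "E = s \<bullet> (v k - x0) - 1 / 2 * (norm (v k - x0))\<^sup>2"
    and "S = (\<Sum>i<k. l i * (F (y i) \<bullet> (y i - x0)))" and "A = (\<Sum>i<k. (norm (y i - v i))\<^sup>2)"
  have "s \<bullet> (u - x0) - 1 / 2 * (norm (u - x0))\<^sup>2 \<le> E - 1 / 2 * (norm (u - v k))\<^sup>2"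
    unfolding E_def by (rule dual_step_strong_concavity[OF X(2) step(1) Suc.prems(2)])
  moreover have "E + S + 1 / 8 * A \<le> 0"
    using Suc.IH[OF run vX] by (simp add: E_def S_def A_def s_def)
  moreover note step_estimate[OF vX Suc.prems(2) step(2,3)]
  moreover have "l k * (F (y k) \<bullet> (y k - u)) = l k * (F (y k) \<bullet> (y k - x0)) - l k * (F (y k) \<bullet> (u - x0))"
    by (simp add: inner_diff_right algebra_simps)
  ultimately have "s \<bullet> (u - x0) - l k * (F (y k) \<bullet> (u - x0)) - 1 / 2 * (norm (u - x0))\<^sup>2
      + (S + l k * (F (y k) \<bullet> (y k - x0))) + 1 / 8 * (A + (norm (y k - v k))\<^sup>2) \<le> 0"
    unfolding distrib_left by linarith
  moreover have "- (\<Sum>i<Suc k. l i *\<^sub>R F (y i)) \<bullet> (u - x0) = s \<bullet> (u - x0) - l k * (F (y k) \<bullet> (u - x0))"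
    by (simp add: s_def inner_diff_left inner_add_left)
  ultimately show ?case
    unfolding S_def A_def sum.lessThan_Suc by simp
qed simp

lemma perseus_run_regret:
  assumes run: "perseus_run V X F p x0 L k v y l" and u: "u \<in> X"
  shows "(\<Sum>i<k. l i * (F (y i) \<bullet> (y i - u))) + 1 / 8 * (\<Sum>i<k. (norm (y i - v i))\<^sup>2)
         \<le> 1 / 2 * (norm (x0 - u))\<^sup>2"
proof -
  \<comment> \<open>Moving the reference point from \<open>x0\<close> to \<open>u\<close> produces the linear part of the dual objective at \<open>u\<close>.\<close>
  have "(\<Sum>i<k. l i * (F (y i) \<bullet> (y i - u))) =
      (\<Sum>i<k. l i * (F (y i) \<bullet> (y i - x0)) - l i * (F (y i) \<bullet> (u - x0)))"
    by (intro sum.cong) (auto simp: inner_diff_right algebra_simps)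
  also have "\<dots> = (\<Sum>i<k. l i * (F (y i) \<bullet> (y i - x0))) - (\<Sum>i<k. l i *\<^sub>R F (y i)) \<bullet> (u - x0)"
    by (simp add: sum_subtractf inner_sum_left)
  finally show ?thesis
    using perseus_run_potential[OF run u] by (simp add: norm_minus_commute)
qed

text \<open>
  Both parts of the regret inequality at \<open>u = z\<close> are used. The gaps satisfy \<open>\<Sum>\<^sub>i a\<^sub>i\<^sup>2 \<le> 4 R\<^sup>2\<close>, that is,
  their quadratic mean is at most \<open>M = 2 R / \<surd>T\<close>; as \<open>\<lambda>\<^sub>i \<ge> c / a\<^sub>i\<^bsup>p-1\<^esup>\<close>, this yields
  \<open>\<Lambda> \<ge> c T / M\<^bsup>p-1\<^esup>\<close>, and for a \<open>T\<close> of the assumed size the right-hand side is at least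
  \<open>1 / (\<mu> R\<^bsup>p-1\<^esup>)\<close>. On the other hand, monotonicity and convexity bound \<open>\<mu> \<Lambda>\<close> times the
  \<open>(p+1)\<close>-st power of the final distance by \<open>R\<^sup>2 / 2\<close>.
\<close>

lemma perseus_run_contraction:
  assumes run: "perseus_run V X F p x0 L T v y l" and R: "x0 \<noteq> z"
    and T: "2 ^ (p + 1) * (5 * real p - 2) / fact p * (L / \<mu>) \<le> sqrt (real T) ^ (p + 1)"
  defines "\<Lambda> \<equiv> (\<Sum>i<T. l i)"
  shows "\<Lambda> > 0"
    and "norm ((1 / \<Lambda>) *\<^sub>R (\<Sum>i<T. l i *\<^sub>R y i) - z) ^ (p + 1) \<le> 1 / 2 * norm (x0 - z) ^ (p + 1)"
proof -
  define R where "R = norm (x0 - z)"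
  define a where "a i = norm (y i - v i)" for i
  define M where "M = 2 * R / sqrt (real T)"
  define c where "c = fact p / ((20 * real p - 8) * L)"
  obtain n where n: "p = Suc n"
    using p by (cases p) auto
  have R0: "R > 0"
    using \<open>x0 \<noteq> z\<close> by (simp add: R_def)
  have step: "subproblem_answer V X F p L (v i) (y i)" "\<not> (p \<ge> 2 \<and> y i = v i)"
    "step_size p L (v i) (y i) (l i)" if "i < T" for i
    using run that by (auto simp: perseus_run_def)
  have yX: "y i \<in> X" and l0: "l i > 0" if "i < T" for i
    using subproblem_answerD(1)[OF step(1)[OF that]] step(3)[OF that] by (auto simp: step_size_def)
  have P: "5 * real p - 2 > 0"
    using p by simp
  have "0 < 2 ^ (p + 1) * (5 * real p - 2) / fact p * (L / \<mu>)"
    using P L \<mu> by simp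
  then have T0: "T > 0"
    using T by (cases "T = 0") auto
  then have M0: "M > 0"
    using R0 by (simp add: M_def)
  have gap: "(\<Sum>i<T. l i * (F (y i) \<bullet> (y i - z))) + 1 / 8 * (\<Sum>i<T. (a i)\<^sup>2) \<le> 1 / 2 * R\<^sup>2"
    using perseus_run_regret[OF run solution_in] by (simp add: a_def R_def)
  have "(\<Sum>i<T. \<mu> * (l i * norm (y i - z) ^ (p + 1))) \<le> (\<Sum>i<T. l i * (F (y i) \<bullet> (y i - z)))"
  proof (intro sum_mono)
    fix i assume i: "i \<in> {..<T}"
    show "\<mu> * (l i * norm (y i - z) ^ (p + 1)) \<le> l i * (F (y i) \<bullet> (y i - z))"
      using mult_left_mono[OF monotone_at_solution[OF yX], of i "l i"] l0[of i] i
      by (simp add: mult_ac)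
  qed
  then have mono: "\<mu> * (\<Sum>i<T. l i * norm (y i - z) ^ (p + 1)) \<le> (\<Sum>i<T. l i * (F (y i) \<bullet> (y i - z)))"
    by (simp add: sum_distrib_left)
  have "0 \<le> \<mu> * (\<Sum>i<T. l i * norm (y i - z) ^ (p + 1))"
    using \<mu> l0 by (intro mult_nonneg_nonneg sum_nonneg) (auto simp: less_imp_le)
  then have "(\<Sum>i<T. (a i)\<^sup>2) \<le> 4 * R\<^sup>2"
    using gap mono by linarith
  then have sq: "(\<Sum>i<T. (a i)\<^sup>2) \<le> real T * M\<^sup>2"
    using T0 by (simp add: M_def power_divide power_mult_distrib)
  have pos: "n = 0 \<or> a i > 0" if "i < T" for i
    using step(2)[OF that] n by (auto simp: a_def)
  have l_ge: "c * (1 / a i ^ n) \<le> l i" if i: "i < T" for i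
  proof -
    have "a i ^ n > 0"
      using pos[OF i] by auto
    moreover have "1 / (20 * real p - 8) \<le> l i * L * a i ^ n / fact p"
      using step(3)[OF i] n by (simp add: step_size_def a_def)
    ultimately show ?thesis
      using L P by (simp add: c_def field_simps)
  qed
  have c0: "c > 0"
    using P L by (simp add: c_def)
  have "1 / (\<mu> * R ^ n) \<le> c * (real T / M ^ n)"
  proof -
    have "sqrt (real T) ^ (p + 1) = real T * sqrt (real T) ^ n"
      by (simp add: n mult.assoc[symmetric])
    then have "real T / M ^ n = sqrt (real T) ^ (p + 1) / (2 * R) ^ n"
      by (simp add: M_def power_divide)
    moreover have "2 ^ (p + 1) * (5 * real p - 2) / fact p * (L / \<mu>) / (2 * R) ^ n \<le>
        sqrt (real T) ^ (p + 1) / (2 * R) ^ n"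
      using T R0 by (intro divide_right_mono) auto
    ultimately have "c * (2 ^ (p + 1) * (5 * real p - 2) / fact p * (L / \<mu>) / (2 * R) ^ n) \<le> c * (real T / M ^ n)"
      using c0 by (intro mult_left_mono) auto
    moreover have "20 * real p - 8 = 4 * (5 * real p - 2)"
      by simp
    then have "c * (2 ^ (p + 1) * (5 * real p - 2) / fact p * (L / \<mu>) / (2 * R) ^ n) = 1 / (\<mu> * R ^ n)"
      using P L \<mu> R0 unfolding c_def by (simp only:) (simp add: n power_mult_distrib del: fact_Suc)
    ultimately show ?thesis by simp
  qed
  also have "\<dots> \<le> c * (\<Sum>i<T. 1 / a i ^ n)"
    using sum_inverse_power_ge[OF M0 sq, of n] pos c0 by (intro mult_left_mono) auto
  also have "\<dots> \<le> \<Lambda>"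
    unfolding \<Lambda>_def sum_distrib_left using l_ge by (intro sum_mono) auto
  finally have \<Lambda>: "1 / (\<mu> * R ^ n) \<le> \<Lambda>" .
  show \<Lambda>0: "\<Lambda> > 0"
    using \<mu> R0 by (intro less_le_trans[OF _ \<Lambda>]) simp
  define N where "N = norm ((1 / \<Lambda>) *\<^sub>R (\<Sum>i<T. l i *\<^sub>R y i) - z) ^ (p + 1)"
  have "\<Lambda> * N \<le> (\<Sum>i<T. l i * norm (y i - z) ^ (p + 1))"
    unfolding N_def using l0 \<Lambda>0 by (intro norm_weighted_average_power_le) (auto simp: \<Lambda>_def less_imp_le)
  then have "\<mu> * (\<Lambda> * N) \<le> \<mu> * (\<Sum>i<T. l i * norm (y i - z) ^ (p + 1))"
    using \<mu> by (intro mult_left_mono) auto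
  also have "\<dots> \<le> 1 / 2 * R\<^sup>2"
    using mono gap sum_nonneg[of "{..<T}" "\<lambda>i. (a i)\<^sup>2"] by simp
  finally have "(\<mu> * \<Lambda>) * N \<le> 1 / 2 * R\<^sup>2"
    by (simp add: mult_ac)
  moreover have "1 / R ^ n \<le> \<mu> * \<Lambda>"
    using \<Lambda> \<mu> R0 by (simp add: field_simps)
  then have "1 / R ^ n * N \<le> (\<mu> * \<Lambda>) * N"
    by (intro mult_right_mono) (auto simp: N_def)
  ultimately have "1 / R ^ n * N \<le> 1 / 2 * R\<^sup>2"
    by linarith
  then have "N \<le> 1 / 2 * R\<^sup>2 * R ^ n"
    using R0 by (simp add: field_simps)
  also have "\<dots> = 1 / 2 * R ^ (p + 1)"
    by (simp add: n power2_eq_square)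
  finally show "norm ((1 / \<Lambda>) *\<^sub>R (\<Sum>i<T. l i *\<^sub>R y i) - z) ^ (p + 1) \<le> 1 / 2 * norm (x0 - z) ^ (p + 1)"
    by (simp add: N_def R_def)
qed

end

section \<open>Restarting\<close>

lemma T_inner_ge:
  assumes "p \<ge> 1" "L > 0" "\<mu> > 0"
  shows "2 ^ (p + 1) * (5 * real p - 2) / fact p * (L / \<mu>) \<le> sqrt (real (T_inner p L \<mu>)) ^ (p + 1)"
proof -
  define A where "A = 2 ^ (p + 1) * (5 * real p - 2) / fact p * (L / \<mu>)"
  have A: "A > 0"
    using assms by (simp add: A_def)
  have "A powr (2 / (real p + 1)) \<le> real (T_inner p L \<mu>)"
    unfolding T_inner_def A_def by linarith
  then have "(A powr (2 / (real p + 1))) powr (1 / 2) \<le> sqrt (real (T_inner p L \<mu>))"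
    by (simp add: powr_half_sqrt)
  moreover have "2 / (real p + 1) * (1 / 2) = 1 / (real p + 1)"
    by (simp add: field_simps)
  ultimately have "A powr (1 / (real p + 1)) \<le> sqrt (real (T_inner p L \<mu>))"
    by (simp only: powr_powr)
  then have "(A powr (1 / (real p + 1))) ^ (p + 1) \<le> sqrt (real (T_inner p L \<mu>)) ^ (p + 1)"
    by (intro power_mono) auto
  also have "(A powr (1 / (real p + 1))) ^ (p + 1) = A"
    using A by (simp only: powr_power) (simp add: add.commute)
  finally show ?thesis
    by (simp add: A_def)
qed

text \<open>
  The bound on \<open>\<mu>\<close> makes the real number under the ceiling at least \<open>1\<close>, so that rounding up at most
  doubles it.
\<close>

lemma T_inner_le:
  assumes p: "p \<ge> 1" and "\<mu> > 0" and \<kappa>: "\<mu> \<le> L / fact p"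
  shows "real (T_inner p L \<mu>) \<le>
     2 * (2 ^ (p + 1) * (5 * real p - 2) / fact p) powr (2 / (real p + 1)) * (L / \<mu>) powr (2 / (real p + 1))"
proof -
  let ?q = "2 / (real p + 1)"
  define c where "c = 2 ^ (p + 1) * (5 * real p - 2)"
  have "L / \<mu> \<ge> fact p"
    using \<kappa> \<open>\<mu> > 0\<close> by (simp add: field_simps)
  then have \<kappa>1: "1 \<le> (L / \<mu>) / fact p"
    by (simp only: le_divide_eq_1_pos fact_gt_zero)
  have "1 * 1 \<le> c"
    unfolding c_def using p by (intro mult_mono one_le_power) auto
  then have "1 * 1 \<le> c * ((L / \<mu>) / fact p)"
    using \<kappa>1 by (intro mult_mono) auto
  then have "1 \<le> c / fact p * (L / \<mu>)"
    by (simp add: mult.commute)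
  then have "1 \<le> (c / fact p * (L / \<mu>)) powr ?q"
    by (intro ge_one_powr_ge_zero) auto
  then have "real (T_inner p L \<mu>) \<le> 2 * (c / fact p * (L / \<mu>)) powr ?q"
    unfolding T_inner_def c_def by linarith
  also have "(c / fact p * (L / \<mu>)) powr ?q = (c / fact p) powr ?q * (L / \<mu>) powr ?q"
    by (rule powr_mult)
  finally show ?thesis
    by (simp add: c_def mult.assoc)
qed

context perseus_problem
begin

lemma perseus_state_in:
  assumes "perseus_state V X F p x0 L T k x s \<Lambda> w" "x0 \<in> X"
  shows "x \<in> X"
  using assms by induction (auto dest: subproblem_answerD(1))

lemma perseus_output_halves:
  assumes x0: "x0 \<in> X" "\<not> vi_solution X F x0"
    and out: "perseus_output V X F p x0 L (T_inner p L \<mu>) y m"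
  shows "y \<in> X \<and> m \<le> T_inner p L \<mu> \<and> norm (y - z) ^ (p + 1) \<le> 1 / 2 * norm (x0 - z) ^ (p + 1)"
  using out
proof cases
  case (stop_at_solution s \<Lambda> w)
  then have "y = z"
    using solution_unique by blast
  then show ?thesis
    using stop_at_solution solution_in by simp
next
  case (stop_at_fixpoint k x s \<Lambda> w v)
  have "y \<in> X"
    using stop_at_fixpoint subproblem_answerD(1) by blast
  then have "vi_solution X F y"
    using stop_at_fixpoint fixpoint_is_solution[of v] X(1) by auto
  then have "y = z"
    by (rule solution_unique)
  then show ?thesis
    using stop_at_fixpoint solution_in by simp
next
  case (finish x s \<Lambda> w)
  obtain v y' l where run: "perseus_run V X F p x0 L (T_inner p L \<mu>) v y' l"
    and \<Lambda>: "\<Lambda> = (\<Sum>i<T_inner p L \<mu>. l i)" and w: "w = (\<Sum>i<T_inner p L \<mu>. l i *\<^sub>R y' i)"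
    using perseus_state_imp_run[OF finish(3)] by blast
  have "x0 \<noteq> z"
    using x0 solution by blast
  note contraction = perseus_run_contraction[OF run this T_inner_ge[OF p L \<mu>], folded \<Lambda> w]
  have "(\<Sum>i<T_inner p L \<mu>. (l i / \<Lambda>) *\<^sub>R y' i) \<in> X"
  proof (rule convex_sum)
    show "(\<Sum>i<T_inner p L \<mu>. l i / \<Lambda>) = 1"
      using contraction(1) by (simp add: sum_divide_distrib[symmetric] \<Lambda>[symmetric])
    fix i assume "i \<in> {..<T_inner p L \<mu>}"
    then show "l i / \<Lambda> \<ge> 0" "y' i \<in> X"
      using run contraction(1) subproblem_answerD(1) by (auto simp: perseus_run_def step_size_def)
  qed (use X in auto)
  then have "(1 / \<Lambda>) *\<^sub>R w \<in> X"
    by (simp add: w scaleR_sum_right)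
  then show ?thesis
    using finish contraction(2) by simp
qed

lemma restart_state_invariant:
  assumes "restart_state V X F p x0 L \<mu> T k x n" and x0: "x0 \<in> X"
  shows "x \<in> X \<and> n \<le> k * T_inner p L \<mu> \<and> norm (x - z) ^ (p + 1) \<le> (1 / 2) ^ k * norm (x0 - z) ^ (p + 1)"
  using assms(1)
proof induction
  case init
  then show ?case using x0 by simp
next
  case (step k x n y m)
  then show ?case
    using perseus_output_halves[of x y m] by auto
qed

lemma restart_output_bounds:
  assumes x0: "x0 \<in> X" and "\<epsilon> > 0" and T: "norm (x0 - z) ^ (p + 1) \<le> 2 ^ Suc T * \<epsilon> ^ (p + 1)"
    and out: "restart_output V X F p x0 L \<mu> T y n"
  shows "norm (y - z) \<le> \<epsilon>" and "n \<le> Suc T * T_inner p L \<mu>"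
proof -
  have "norm (y - z) \<le> \<epsilon> \<and> n \<le> Suc T * T_inner p L \<mu>"
    using out
  proof cases
    case (stop_at_solution k)
    then have "n \<le> k * T_inner p L \<mu>" "y = z"
      using restart_state_invariant[OF _ x0] solution_unique by blast+
    moreover have "k * T_inner p L \<mu> \<le> Suc T * T_inner p L \<mu>"
      using stop_at_solution by (intro mult_right_mono) auto
    ultimately show ?thesis
      using \<open>\<epsilon> > 0\<close> by simp
  next
    case finish
    note invariant = restart_state_invariant[OF finish x0]
    have "norm (y - z) ^ (p + 1) \<le> (1 / 2) ^ Suc T * norm (x0 - z) ^ (p + 1)"
      using invariant by blast
    also have "\<dots> \<le> (1 / 2) ^ Suc T * (2 ^ Suc T * \<epsilon> ^ (p + 1))"
      using T by (intro mult_left_mono) auto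
    also have "\<dots> = \<epsilon> ^ (p + 1)"
      by (simp add: power_one_over)
    finally have "norm (y - z) ^ Suc p \<le> \<epsilon> ^ Suc p"
      by simp
    then show ?thesis
      using invariant \<open>\<epsilon> > 0\<close> power_le_imp_le_base[of "norm (y - z)" p \<epsilon>] by simp
  qed
  then show "norm (y - z) \<le> \<epsilon>" "n \<le> Suc T * T_inner p L \<mu>"
    by auto
qed

end

section \<open>The complexity bound\<close>

lemma inner_single_one: "x \<bullet> Poly_Mapping.single i (1::real) = Poly_Mapping.lookup x i"
proof -
  have "x \<bullet> Poly_Mapping.single i (1::real) = Poly_Mapping.single i 1 \<bullet> x"
    by (rule inner_commute)
  then show ?thesis
    by (simp add: inner_poly_mapping_def)
qed

lemma framed_subspace_Rn: "framed_subspace (Rn d) ((\<lambda>i. Poly_Mapping.single i 1) ` {..<d})"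
proof
  show "(\<lambda>i. Poly_Mapping.single i (1::real)) ` {..<d} \<subseteq> Rn d"
    by (auto simp: Rn_def)
  fix h assume h: "h \<in> Rn d"
  have lookup_sum: "Poly_Mapping.lookup (\<Sum>i\<in>I. g i) j = (\<Sum>i\<in>I. Poly_Mapping.lookup (g i) j)"
    for g :: "nat \<Rightarrow> nat \<Rightarrow>\<^sub>0 real" and I j
    by (induction I rule: infinite_finite_induct) (auto simp: lookup_add)
  have inj: "inj_on (\<lambda>i. Poly_Mapping.single i (1::real)) {..<d}"
    by (auto intro!: inj_onI) (metis lookup_single_eq lookup_single_not_eq zero_neq_one)
  have "h = (\<Sum>i<d. Poly_Mapping.lookup h i *\<^sub>R Poly_Mapping.single i 1)"
  proof (rule poly_mapping_eqI)
    fix j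
    have "Poly_Mapping.lookup (\<Sum>i<d. Poly_Mapping.lookup h i *\<^sub>R Poly_Mapping.single i 1) j =
        (\<Sum>i<d. if i = j then Poly_Mapping.lookup h i else 0)"
      unfolding lookup_sum by (intro sum.cong) (auto simp: scaleR_poly_mapping.rep_eq lookup_single)
    also have "\<dots> = Poly_Mapping.lookup h j"
      using h by (auto simp: Rn_def in_keys_iff subset_iff)
    finally show "Poly_Mapping.lookup h j =
        Poly_Mapping.lookup (\<Sum>i<d. Poly_Mapping.lookup h i *\<^sub>R Poly_Mapping.single i 1) j" ..
  qed
  then show "h = (\<Sum>b\<in>(\<lambda>i. Poly_Mapping.single i 1) ` {..<d}. (h \<bullet> b) *\<^sub>R b)"
    by (simp add: sum.reindex[OF inj] inner_single_one)
qed (auto simp: subspace_Rn)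

text \<open>
  The number of halvings of the \<open>(p+1)\<close>-st power of the distance that lead from \<open>D\<close> to \<open>\<epsilon>\<close>. The
  extra \<open>2\<close> in \<open>p + 3\<close> pays for the rounding and for the round with index \<open>0\<close>.
\<close>

lemma log_rounds:
  fixes p :: nat and D \<epsilon> :: real
  assumes "D > 0" "\<epsilon> > 0"
  defines "T \<equiv> nat \<lceil>(real p + 1) * log 2 (D / \<epsilon>)\<rceil>"
  shows "D ^ (p + 1) \<le> 2 ^ Suc T * \<epsilon> ^ (p + 1)"
    and "real T + 1 \<le> (real p + 3) * max 1 (log 2 (D / \<epsilon>))"
proof -
  have "(D / \<epsilon>) ^ (p + 1) = 2 powr (log 2 (D / \<epsilon>) * (real p + 1))"
    using assms by (simp add: powr_powr[symmetric] powr_add powr_realpow)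
  also have "\<dots> \<le> 2 powr real (Suc T)"
    unfolding T_def by (intro powr_mono) (auto simp: mult.commute, linarith)
  also have "\<dots> = 2 ^ Suc T"
    by (rule powr_realpow) simp
  finally show "D ^ (p + 1) \<le> 2 ^ Suc T * \<epsilon> ^ (p + 1)"
    using \<open>\<epsilon> > 0\<close> by (simp add: power_divide divide_le_eq)
  have "(real p + 1) * log 2 (D / \<epsilon>) \<le> (real p + 1) * max 1 (log 2 (D / \<epsilon>))"
    by (intro mult_left_mono) auto
  moreover have "0 \<le> (real p + 1) * max 1 (log 2 (D / \<epsilon>))"
    by (intro mult_nonneg_nonneg) auto
  ultimately have "real T \<le> (real p + 1) * max 1 (log 2 (D / \<epsilon>)) + 1"
    unfolding T_def by linarith
  then show "real T + 1 \<le> (real p + 3) * max 1 (log 2 (D / \<epsilon>))"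
    by (simp add: algebra_simps)
qed

theorem theorem3p2:
  fixes p :: nat
  assumes "p \<ge> 1"
  shows "\<exists>C::real. C > 0 \<and> (\<exists>T :: real \<Rightarrow> real \<Rightarrow> nat.
    \<forall>(d::nat) (L::real) (\<mu>::real) (X :: (nat \<Rightarrow>\<^sub>0 real) set) (D::real)
      (F :: (nat \<Rightarrow>\<^sub>0 real) \<Rightarrow> (nat \<Rightarrow>\<^sub>0 real)) xstar x0 (\<epsilon>::real).
      d \<ge> 1 \<longrightarrow> L > 0 \<longrightarrow> \<mu> > 0 \<longrightarrow>
      X \<subseteq> Rn d \<longrightarrow> closed X \<longrightarrow> convex X \<longrightarrow> bounded X \<longrightarrow> D = diameter X \<longrightarrow> D > 0 \<longrightarrow>
      F \<in> Rn d \<rightarrow> Rn d \<longrightarrow> order_smooth (p - 1) L (Rn d) F \<longrightarrow>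
      order_uniformly_monotone p \<mu> (Rn d) F \<longrightarrow>
      weak_vi_solution X F xstar \<longrightarrow> x0 \<in> X \<longrightarrow> 0 < \<epsilon> \<longrightarrow> \<epsilon> < 1 \<longrightarrow>
      real (T D \<epsilon>) \<le> C * max 1 (log 2 (D / \<epsilon>)) \<and>
      (\<forall>z n. restart_output (Rn d) X F p x0 L \<mu> (T D \<epsilon>) z n \<longrightarrow>
         norm (z - xstar) \<le> \<epsilon> \<and>
         real n \<le> C * (L / \<mu>) powr (2 / (real p + 1)) * max 1 (log 2 (D / \<epsilon>))))"
proof -
  define c where "c = 2 * (2 ^ (p + 1) * (5 * real p - 2) / fact p) powr (2 / (real p + 1))"
  define C where "C = (real p + 3) * (1 + c)"
  define T where "T D \<epsilon> = nat \<lceil>(real p + 1) * log 2 (D / \<epsilon>)\<rceil>" for D \<epsilon> :: real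
  have c: "c \<ge> 0"
    by (simp add: c_def)
  have C: "C \<ge> real p + 3" "C \<ge> (real p + 3) * c" "C > 0"
    using c assms by (auto simp: C_def distrib_left intro!: add_pos_nonneg)
  have "real (T D \<epsilon>) \<le> C * max 1 (log 2 (D / \<epsilon>)) \<and>
      (\<forall>z n. restart_output (Rn d) X F p x0 L \<mu> (T D \<epsilon>) z n \<longrightarrow>
         norm (z - xstar) \<le> \<epsilon> \<and>
         real n \<le> C * (L / \<mu>) powr (2 / (real p + 1)) * max 1 (log 2 (D / \<epsilon>)))"
    if "d \<ge> 1" "L > 0" "\<mu> > 0" "X \<subseteq> Rn d" "convex X" "bounded X" "D = diameter X" "D > 0"
      and smooth: "order_smooth (p - 1) L (Rn d) F"
      and monotone: "order_uniformly_monotone p \<mu> (Rn d) F"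
      and weak: "weak_vi_solution X F xstar" and "x0 \<in> X" "0 < \<epsilon>"
    for d L \<mu> D \<epsilon> xstar x0 and X :: "(nat \<Rightarrow>\<^sub>0 real) set" and F :: "(nat \<Rightarrow>\<^sub>0 real) \<Rightarrow> nat \<Rightarrow>\<^sub>0 real"
  proof (intro conjI allI impI)
    let ?l = "max 1 (log 2 (D / \<epsilon>))" and ?\<kappa> = "(L / \<mu>) powr (2 / (real p + 1))"
    interpret framed_subspace "Rn d" "(\<lambda>i. Poly_Mapping.single i 1) ` {..<d}"
      by (rule framed_subspace_Rn)
    interpret perseus_problem "Rn d" "(\<lambda>i. Poly_Mapping.single i 1) ` {..<d}" X F p L \<mu> xstar
      by unfold_locales (use that assms in auto)
    note rounds = log_rounds[OF \<open>D > 0\<close> \<open>0 < \<epsilon>\<close>, of p, folded T_def]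
    have "(real p + 3) * ?l \<le> C * ?l"
      using C(1) by (intro mult_right_mono) auto
    then show "real (T D \<epsilon>) \<le> C * ?l"
      using rounds(2) by linarith
    fix y n assume out: "restart_output (Rn d) X F p x0 L \<mu> (T D \<epsilon>) y n"
    have "norm (x0 - xstar) \<le> D"
      using diameter_bounded_bound[OF \<open>bounded X\<close> \<open>x0 \<in> X\<close> solution_in] \<open>D = diameter X\<close>
      by (simp add: dist_norm)
    then have "norm (x0 - xstar) ^ (p + 1) \<le> 2 ^ Suc (T D \<epsilon>) * \<epsilon> ^ (p + 1)"
      using rounds(1) power_mono[of "norm (x0 - xstar)" D "p + 1"] by simp
    note bounds = restart_output_bounds[OF \<open>x0 \<in> X\<close> \<open>0 < \<epsilon>\<close> this out]
    show "norm (y - xstar) \<le> \<epsilon>"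
      by (rule bounds(1))
    have "norm (Poly_Mapping.single 0 1 :: nat \<Rightarrow>\<^sub>0 real) = 1"
      unfolding norm_eq_sqrt_inner inner_single_one lookup_single_eq by simp
    moreover have "Poly_Mapping.single 0 1 \<in> Rn d"
      using \<open>d \<ge> 1\<close> by (simp add: Rn_def)
    ultimately have "\<mu> \<le> L / fact p"
      using smoothness_dominates_monotonicity[OF smooth, of \<mu>] monotone assms \<open>L > 0\<close> by simp
    then have inner: "real (T_inner p L \<mu>) \<le> c * ?\<kappa>"
      using T_inner_le[OF assms \<open>\<mu> > 0\<close>, of L] by (simp add: c_def)
    have "real n \<le> real (Suc (T D \<epsilon>) * T_inner p L \<mu>)"
      using bounds(2) by (rule of_nat_mono)
    also have "\<dots> = (real (T D \<epsilon>) + 1) * real (T_inner p L \<mu>)"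
      by (simp add: algebra_simps)
    also have "\<dots> \<le> ((real p + 3) * ?l) * (c * ?\<kappa>)"
      using rounds(2) inner by (intro mult_mono) auto
    also have "\<dots> = ((real p + 3) * c) * (?\<kappa> * ?l)"
      by (simp add: mult_ac)
    also have "\<dots> \<le> C * (?\<kappa> * ?l)"
      using C(2) by (intro mult_right_mono) auto
    finally show "real n \<le> C * ?\<kappa> * ?l"
      by (simp add: mult.assoc)
  qed
  with C(3) show ?thesis
    by (intro exI[of _ C] conjI exI[of _ T] allI impI) blast+
qed

end
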